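(* For every $\omega\in K$ there exists an uncountable set of maps $f\in\Gamma^1_\omega(\mathbb S^1)$ each of which preserves a probability measure $\mu_f$ equivalent to Lebesgue measure whose density $\rho_f=d\mu_f/dm$ is continuous and satisfies $\omega_{\rho_f}\simeq\omega$. Moreover, these maps can be given in the following explicit form: each of them is the circle map represented by $$f_\rho(x)=\begin{cases}2g(x), & x\in[0,\tfrac12],\\ \left(g-\tfrac12 I\right)^{-1}\left(g(x)-\tfrac12\right), & x\in[\tfrac12,1],\end{cases}\qquad g(x)=\int_0^x\rho(t)\,dt,$$ where $I$ is the identity map of $[0,1]$ and $\rho:[0,1]\to\mathbb R$ is a continuous function with $\rho>\tfrac12$, having $\omega$ as an optimal modulus of continuity, and satisfying $\int_0^{1/2}\rho=\int_{1/2}^1\rho=\tfrac12$, $\max_{[0,1]}\rho-\min_{[0,1]}\rho<\tfrac12$ and $\rho(0)=\rho(1)=1$.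
   Context: $\mathbb R^+=[0,\infty)$; $\mathbb S^1=\mathbb R/\mathbb Z$ with the arc-length metric $d$; $m$ is Lebesgue measure. $E^1(\mathbb S^1)$ is the set of $C^1$ uniformly expanding maps $f:\mathbb S^1\to\mathbb S^1$ (i.e. $\min|f'|>1$). A map of $[0,1]$ with two increasing branches mapping $[0,\frac12]$ and $[\frac12,1]$ onto $[0,1]$ represents a map of $\mathbb S^1$ by identifying $0$ and $1$. For a continuous real function $\rho$ on a compact metric space $X$, the canonical modulus of continuity is $\omega_\rho(t)=\sup\{|\rho(x)-\rho(y)|: d(x,y)<t\}$ for $t>0$, with $\omega_\rho(0)=0$. $K$ is the set of continuous, non-decreasing, concave functions $\omega:\mathbb R^+\to\mathbb R^+$ with $\omega(0)=0$ and $\omega\not\equiv0$. For moduli of continuity, $\omega\simeq\tilde\omega$ means that the ratio $\omega/\tilde\omega$ is bounded above and bounded below by positive constants on some interval $(0,t_0]$, $t_0>0$. One says $\omega\in K$ is an optimal modulus of continuity for $\rho$ if $\omega\simeq\omega_\rho$. $E^1_\omega(\mathbb S^1)=\{f\in E^1(\mathbb S^1):\omega_{f'}\simeq\omega\}$, and $\Gamma^1_\omega(\mathbb S^1)$ is the set of $f\in E^1_\omega(\mathbb S^1)$ that admit an invariant probability measure equivalent to Lebesgue (i.e. mutually absolutely continuous with it). *)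

theory Defs
  imports "HOL-Analysis.Analysis" "HOL-Probability.Probability"
begin

section \<open>The circle \<open>\<real>/\<int>\<close>\<close>

quotient_type circle = real / "\<lambda>x y :: real. x - y \<in> \<int>"
proof (rule equivpI)
  show "reflp (\<lambda>x y :: real. x - y \<in> \<int>)" by (simp add: reflp_def)
  show "symp (\<lambda>x y :: real. x - y \<in> \<int>)"
    by (metis (mono_tags, lifting) Ints_minus minus_diff_eq sympI)
  show "transp (\<lambda>x y :: real. x - y \<in> \<int>)"
  proof (rule transpI)
    fix x y z :: real
    assume "x - y \<in> \<int>" "y - z \<in> \<int>"
    then have "(x - y) + (y - z) \<in> \<int>" by (rule Ints_add)
    then show "x - z \<in> \<int>" by simp
  qed
qed

lift_definition circle_of :: "real \<Rightarrow> circle" is "\<lambda>x. x" .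

lemma circle_of_eq_iff: "circle_of x = circle_of y \<longleftrightarrow> x - y \<in> \<int>"
  by transfer simp

lemma circle_of_surj: "\<exists>x. p = circle_of x"
  by transfer (metis Ints_0 diff_self)

lemma infdist_Ints_le: "infdist x \<int> \<le> infdist y \<int>" if "x - y \<in> \<int>" for x y :: real
proof -
  have "infdist x \<int> \<le> dist y a" if "a \<in> \<int>" for a
    using infdist_le[of "a + (x - y)" \<int> x] that \<open>x - y \<in> \<int>\<close> by (auto simp: dist_real_def)
  moreover have "(\<int> :: real set) \<noteq> {}"
    using Ints_0 by blast
  ultimately show ?thesis
    unfolding infdist_notempty[OF \<open>(\<int> :: real set) \<noteq> {}\<close>, of y]
    by (intro cINF_greatest)
qed

lemma infdist_Ints_cong: "infdist x \<int> = infdist y \<int>" if "x - y \<in> \<int>" for x y :: real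
  using infdist_Ints_le[of x y] infdist_Ints_le[of y x] that Ints_minus[OF that] by simp

lemma infdist_Ints_minus: "infdist (- x) \<int> = infdist x (\<int> :: real set)"
proof -
  have le: "infdist (- x) \<int> \<le> infdist x (\<int> :: real set)" for x :: real
  proof -
    have "infdist (- x) \<int> \<le> dist x a" if "a \<in> \<int>" for a
      using infdist_le[of "- a" \<int> "- x"] that by (simp add: dist_real_def)
    moreover have "(\<int> :: real set) \<noteq> {}"
      using Ints_0 by blast
    ultimately show ?thesis
      unfolding infdist_notempty[OF \<open>(\<int> :: real set) \<noteq> {}\<close>, of x]
      by (intro cINF_greatest)
  qed
  show ?thesis using le[of x] le[of "- x"] by simp
qed

lemma infdist_Ints_add:
  "infdist (x + y) \<int> \<le> infdist x \<int> + infdist y (\<int> :: real set)"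
proof -
  have ne: "(\<int> :: real set) \<noteq> {}"
    using Ints_0 by blast
  have "infdist (x + y) \<int> - infdist x \<int> \<le> dist y a" if "a \<in> \<int>" for a
    using infdist_triangle[of "x + y" \<int> "x + a"] infdist_Ints_cong[of "x + a" x] that
    by (simp add: dist_real_def)
  then have "infdist (x + y) \<int> - infdist x \<int> \<le> infdist y \<int>"
    unfolding infdist_notempty[OF ne, of y] by (intro cINF_greatest ne)
  then show ?thesis by simp
qed

text \<open>
  The length of the shortest arc joining two points is the distance of the difference
  of representatives to the nearest integer.
\<close>

instantiation circle :: metric_space
begin

lift_definition dist_circle :: "circle \<Rightarrow> circle \<Rightarrow> real"
  is "\<lambda>x y. infdist (x - y) \<int>"
proof -
  fix x x' y y' :: real
  assume "x - x' \<in> \<int>" "y - y' \<in> \<int>"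
  then have "(x - x') - (y - y') \<in> \<int>" by (rule Ints_diff)
  then show "infdist (x - y) \<int> = infdist (x' - y') \<int>"
    by (intro infdist_Ints_cong) (simp add: algebra_simps)
qed

definition uniformity_circle :: "(circle \<times> circle) filter"
  where "uniformity_circle = (INF e\<in>{0<..}. principal {(x, y). dist x y < e})"

definition open_circle :: "circle set \<Rightarrow> bool"
  where "open_circle U \<longleftrightarrow> (\<forall>x\<in>U. eventually (\<lambda>(x', y). x' = x \<longrightarrow> y \<in> U) uniformity)"

instance
proof
  fix x y z :: circle
  show "dist x y = 0 \<longleftrightarrow> x = y"
    by transfer (metis Ints_0 closed_Ints empty_iff in_closed_iff_infdist_zero)
  show "dist x y \<le> dist x z + dist y z"
  proof transfer
    fix x y z :: real
    show "infdist (x - y) \<int> \<le> infdist (x - z) \<int> + infdist (y - z) \<int>"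
      using infdist_Ints_add[of "x - z" "z - y"] infdist_Ints_minus[of "y - z"] by simp
  qed
qed (simp_all add: uniformity_circle_def open_circle_def)

end

lemma dist_circle_of: "dist (circle_of x) (circle_of y) = infdist (x - y) \<int>"
  by transfer simp

lemma continuous_on_circle_of: "continuous_on S circle_of"
proof -
  have "dist (circle_of x) (circle_of y) \<le> dist x y" for x y
    using infdist_le[of 0 \<int> "x - y"] by (simp add: dist_circle_of dist_real_def)
  then show ?thesis
    unfolding continuous_on_iff by (meson le_less_trans)
qed

definition circle_lborel :: "circle measure"
  where "circle_lborel = distr (restrict_space lborel {0..<1}) borel circle_of"

lemma measurable_circle_of: "circle_of \<in> measurable (restrict_space lborel {0..<1}) borel"
  using borel_measurable_continuous_onI[OF continuous_on_circle_of[of UNIV]]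
  by (intro measurable_restrict_space1) simp


section \<open>Differentiable circle maps\<close>

text \<open>
  Differentiation in the charts given by the covering map. The function \<open>F\<close> below lifts \<open>f\<close>
  but need not be continuous away from \<open>x\<close>; any two such lifts that are
  continuous at \<open>x\<close> differ by a constant integer near \<open>x\<close>.
\<close>

definition has_circle_deriv :: "(circle \<Rightarrow> circle) \<Rightarrow> real \<Rightarrow> circle \<Rightarrow> bool"
  where "has_circle_deriv f D p \<longleftrightarrow>
    (\<exists>F x. p = circle_of x \<and> (\<forall>y. circle_of (F y) = f (circle_of y)) \<and>
       (F has_real_derivative D) (at x))"

lemma has_circle_deriv_unique:
  assumes "has_circle_deriv f D p" "has_circle_deriv f E p"
  shows "D = E"
proof -
  obtain F x where F: "p = circle_of x" "\<And>y. circle_of (F y) = f (circle_of y)"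
      "(F has_real_derivative D) (at x)"
    using assms(1) unfolding has_circle_deriv_def by blast
  obtain G z where G: "p = circle_of z" "\<And>y. circle_of (G y) = f (circle_of y)"
      "(G has_real_derivative E) (at z)"
    using assms(2) unfolding has_circle_deriv_def by blast
  define n where "n = z - x"
  have n: "n \<in> \<int>"
    using F(1) G(1) circle_of_eq_iff unfolding n_def by metis
  define H where "H = (\<lambda>y. F y - G (y + n))"
  have "circle_of (y + n) = circle_of y" for y
    using n by (simp add: circle_of_eq_iff)
  then have H_Ints: "H y \<in> \<int>" for y
    using F(2)[of y] G(2)[of "y + n"] unfolding H_def circle_of_eq_iff[symmetric] by simp
  have "((\<lambda>y. G (y + n)) has_real_derivative E) (at x)"
    using G(3) unfolding n_def by (subst DERIV_shift[symmetric]) simp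
  then have H_deriv: "(H has_real_derivative D - E) (at x)"
    unfolding H_def by (intro DERIV_diff F(3))
  then have "isCont H x"
    by (rule DERIV_isCont)
  then have "\<forall>\<^sub>F y in nhds x. dist (H y) (H x) < 1"
    unfolding isCont_def tendsto_at_iff_tendsto_nhds by (rule tendstoD) simp
  then have "\<forall>\<^sub>F y in nhds x. H y = H x"
    by eventually_elim
      (metis Ints_diff H_Ints Ints_nonzero_abs_less1 dist_real_def eq_iff_diff_eq_0)
  then have "((\<lambda>_. H x) has_real_derivative D - E) (at x)"
    using H_deriv DERIV_cong_ev[of x x H "\<lambda>_. H x" "D - E" "D - E"] by simp
  then show ?thesis
    using DERIV_unique[OF _ DERIV_const] by force
qed

definition circle_deriv :: "(circle \<Rightarrow> circle) \<Rightarrow> circle \<Rightarrow> real"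
  where "circle_deriv f p = (THE D. has_circle_deriv f D p)"

lemma circle_deriv_eq: "has_circle_deriv f D p \<Longrightarrow> circle_deriv f p = D"
  unfolding circle_deriv_def by (blast intro: has_circle_deriv_unique)

definition circle_C1 :: "(circle \<Rightarrow> circle) \<Rightarrow> bool"
  where "circle_C1 f \<longleftrightarrow> (\<forall>p. \<exists>D. has_circle_deriv f D p) \<and> continuous_on UNIV (circle_deriv f)"

definition expanding_C1 :: "(circle \<Rightarrow> circle) set"
  where "expanding_C1 = {f. circle_C1 f \<and> (\<exists>c>1. \<forall>p. c \<le> \<bar>circle_deriv f p\<bar>)}"


section \<open>Moduli of continuity\<close>

text \<open>Functions on \<open>[0,\<infinity>)\<close> are represented by functions on the reals whose values at
  negative arguments play no role.\<close>

definition canonical_modulus :: "'a::metric_space set \<Rightarrow> ('a \<Rightarrow> real) \<Rightarrow> real \<Rightarrow> real"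
  where "canonical_modulus X \<rho> t =
    (if t \<le> 0 then 0 else Sup {\<bar>\<rho> x - \<rho> y\<bar> | x y. x \<in> X \<and> y \<in> X \<and> dist x y < t})"

definition concave_moduli :: "(real \<Rightarrow> real) set"
  where "concave_moduli = {\<omega>. continuous_on {0..} \<omega> \<and> mono_on {0..} \<omega> \<and> concave_on {0..} \<omega> \<and>
    (\<forall>t\<ge>0. 0 \<le> \<omega> t) \<and> \<omega> 0 = 0 \<and> (\<exists>t\<ge>0. \<omega> t \<noteq> 0)}"

text \<open>A ratio with vanishing denominator is \<open>0\<close>, so the lower bound forces the
  denominator to be nonzero on \<open>(0,t0]\<close>.\<close>

definition modulus_equiv :: "(real \<Rightarrow> real) \<Rightarrow> (real \<Rightarrow> real) \<Rightarrow> bool"  (infix "\<simeq>\<^sub>m" 50)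
  where "\<omega> \<simeq>\<^sub>m \<omega>' \<longleftrightarrow>
    (\<exists>t0>0. \<exists>c>0. \<exists>C>0. \<forall>t\<in>{0<..t0}. c \<le> \<omega> t / \<omega>' t \<and> \<omega> t / \<omega>' t \<le> C)"

definition expanding_C1_mod :: "(real \<Rightarrow> real) \<Rightarrow> (circle \<Rightarrow> circle) set"
  where "expanding_C1_mod \<omega> = {f \<in> expanding_C1. canonical_modulus UNIV (circle_deriv f) \<simeq>\<^sub>m \<omega>}"


section \<open>Invariant measures\<close>

definition equivalent_measures :: "'a measure \<Rightarrow> 'a measure \<Rightarrow> bool"
  where "equivalent_measures M N \<longleftrightarrow>
    sets M = sets N \<and> absolutely_continuous M N \<and> absolutely_continuous N M"

definition invariant_prob :: "(circle \<Rightarrow> circle) \<Rightarrow> circle measure \<Rightarrow> bool"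
  where "invariant_prob f \<mu> \<longleftrightarrow>
    prob_space \<mu> \<and> sets \<mu> = sets borel \<and> f \<in> measurable \<mu> \<mu> \<and> distr \<mu> \<mu> f = \<mu>"

definition Gamma_C1 :: "(real \<Rightarrow> real) \<Rightarrow> (circle \<Rightarrow> circle) set"
  where "Gamma_C1 \<omega> = {f \<in> expanding_C1_mod \<omega>.
    \<exists>\<mu>. invariant_prob f \<mu> \<and> equivalent_measures \<mu> circle_lborel}"


section \<open>Circle maps given by two branches\<close>

text \<open>The branches \<open>b1\<close> and \<open>b2\<close> take the values \<open>1\<close> and \<open>0\<close> at \<open>1/2\<close>, which are the same
  point of the circle.\<close>

definition represented_by :: "(real \<Rightarrow> real) \<Rightarrow> (real \<Rightarrow> real) \<Rightarrow> (circle \<Rightarrow> circle) \<Rightarrow> bool"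
  where "represented_by b1 b2 f \<longleftrightarrow>
    strict_mono_on {0..1/2} b1 \<and> b1 ` {0..1/2} = {0..1} \<and>
    strict_mono_on {1/2..1} b2 \<and> b2 ` {1/2..1} = {0..1} \<and>
    (\<forall>x\<in>{0..1/2}. f (circle_of x) = circle_of (b1 x)) \<and>
    (\<forall>x\<in>{1/2..1}. f (circle_of x) = circle_of (b2 x))"

definition primitive :: "(real \<Rightarrow> real) \<Rightarrow> real \<Rightarrow> real"
  where "primitive \<rho> x = integral {0..x} \<rho>"

definition left_branch :: "(real \<Rightarrow> real) \<Rightarrow> real \<Rightarrow> real"
  where "left_branch \<rho> x = 2 * primitive \<rho> x"

definition right_branch :: "(real \<Rightarrow> real) \<Rightarrow> real \<Rightarrow> real"
  where "right_branch \<rho> x =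
    inv_into {0..1} (\<lambda>y. primitive \<rho> y - y / 2) (primitive \<rho> x - 1 / 2)"

definition admissible_density :: "(real \<Rightarrow> real) \<Rightarrow> (real \<Rightarrow> real) \<Rightarrow> bool"
  where "admissible_density \<omega> \<rho> \<longleftrightarrow>
    continuous_on {0..1} \<rho> \<and> (\<forall>x\<in>{0..1}. 1/2 < \<rho> x) \<and>
    \<omega> \<simeq>\<^sub>m canonical_modulus {0..1} \<rho> \<and>
    integral {0..1/2} \<rho> = 1/2 \<and> integral {1/2..1} \<rho> = 1/2 \<and>
    Sup (\<rho> ` {0..1}) - Inf (\<rho> ` {0..1}) < 1/2 \<and>
    \<rho> 0 = 1 \<and> \<rho> 1 = 1"

end

theory Submission
  imports Defs
begin

text \<open>
  Write \<open>R\<close> for the density, extended periodically to the line, \<open>G\<close> for its primitive and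
  \<open>h y = G y - y / 2\<close>. A map with increasing full branches \<open>f\<^sub>1\<close> on \<open>[0,1/2]\<close> and \<open>f\<^sub>2\<close> on
  \<open>[1/2,1]\<close> preserves the measure with distribution function \<open>G\<close> when the two preimages of
  \<open>[0,y]\<close> have total mass \<open>G y\<close>. The left branch \<open>2 G\<close> pulls \<open>[0,y]\<close> back to a set of mass
  \<open>y / 2\<close>, so the right branch has to satisfy \<open>G - 1/2 = h \<circ> f\<^sub>2\<close>; this is the formula in the
  theorem. Its derivative is \<open>2 R\<close> on the left and \<open>R / (R \<circ> f\<^sub>2 - 1/2)\<close> on the right. The
  first exceeds \<open>1\<close> because \<open>R > 1/2\<close>, the second because \<open>R\<close> oscillates by less than \<open>1/2\<close>,
  and the two fit together at the points \<open>0\<close> and \<open>1/2\<close> because \<open>R 0 = 1\<close>.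

  Everything is computed with a lift of the circle map to the line. Since \<open>G (x + 1) = G x + 1\<close>
  and \<open>h (y + 1) = h y + 1/2\<close>, the inverse function of \<open>h\<close> yields one function \<open>W = h\<^sup>-\<^sup>1 \<circ> G\<close>
  such that the lift is \<open>2 G\<close> on every interval \<open>[n, n + 1/2]\<close> and \<open>W\<close> on every
  \<open>[n + 1/2, n + 1]\<close>, with no correcting constants (\<open>lift_has_derivative\<close>). Invariance is then
  a change of variables in each branch followed by addition (\<open>transfer_identity\<close>).

  For the moduli of continuity (\<open>optimal_moduli\<close>): the derivative of the map is a
  Lipschitz expression in \<open>R\<close> and \<open>R \<circ> W\<close> with \<open>W\<close> Lipschitz, and a concave \<open>\<omega>\<close> satisfies
  \<open>\<omega> (L t) \<le> L \<omega> t\<close> for \<open>L \<ge> 1\<close>, so the derivative inherits the upper bound from \<open>R\<close>. On the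
  left half the derivative is \<open>2 R\<close>, so it inherits the lower bound too, provided that \<open>R\<close>
  already realises its modulus there.

  It remains to find such densities. A concave \<open>\<omega>\<close> with \<open>\<omega> 0 = 0\<close> is subadditive and hence is
  its own modulus of continuity. Take for \<open>R - 1\<close> a small multiple \<open>a\<close> of the difference of two
  congruent bumps of profile \<open>\<omega>\<close>, over \<open>[0,1/4]\<close> and \<open>[1/4,1/2]\<close>: they cancel in the integral,
  and near \<open>0\<close> the function \<open>R - 1\<close> is \<open>a \<omega>\<close> itself. The amplitude \<open>a\<close> ranges over an interval
  and can be read off from the derivative of the map at \<open>1/8\<close>, so the maps obtained are
  pairwise different and there are uncountably many of them.
\<close>


section \<open>Real functions of one variable\<close>

text \<open>
  Used where two branches meet: whichever branch \<open>F\<close> follows near \<open>x\<close>, both have the same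
  tangent there.
\<close>

lemma has_real_derivative_switch:
  fixes f g F :: "real \<Rightarrow> real"
  assumes "(f has_real_derivative D) (at x)" "(g has_real_derivative D) (at x)" "f x = g x"
    and "\<And>y. F y = f y \<or> F y = g y"
  shows "(F has_real_derivative D) (at x)"
proof -
  have lim: "((\<lambda>y. (f y - f x) / (y - x)) \<longlongrightarrow> D) (at x)" "((\<lambda>y. (g y - g x) / (y - x)) \<longlongrightarrow> D) (at x)"
    using assms(1,2) by (simp_all add: has_field_derivative_iff)
  have "((\<lambda>y. (F y - F x) / (y - x)) \<longlongrightarrow> D) (at x)"
  proof (rule tendstoI)
    fix e :: real assume "e > 0"
    then have "\<forall>\<^sub>F y in at x. dist ((f y - f x) / (y - x)) D < e"
      "\<forall>\<^sub>F y in at x. dist ((g y - g x) / (y - x)) D < e"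
      using lim by (auto dest: tendstoD)
    then show "\<forall>\<^sub>F y in at x. dist ((F y - F x) / (y - x)) D < e"
    proof eventually_elim
      case (elim y)
      have "F x = f x" using assms(3) assms(4)[of x] by auto
      then show ?case using elim assms(3) assms(4)[of y] by auto
    qed
  qed
  then show ?thesis by (simp add: has_field_derivative_iff)
qed

lemma strict_mono_image_Icc:
  fixes f :: "real \<Rightarrow> real"
  assumes "\<And>x y. x < y \<Longrightarrow> f x < f y" "continuous_on {a..b} f" "a \<le> b"
  shows "f ` {a..b} = {f a..f b}"
proof
  show "f ` {a..b} \<subseteq> {f a..f b}"
    using assms(1) by (force simp: order.order_iff_strict)
  show "{f a..f b} \<subseteq> f ` {a..b}"
    using IVT'[of f a _ b] assms(2,3) by fastforce
qed

text \<open>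
  The substitution \<open>x \<mapsto> c - x\<close> turns the integral into its own negative.
\<close>

lemma integral_odd_reflect:
  fixes f :: "real \<Rightarrow> real"
  assumes f: "continuous_on UNIV f" and odd: "\<And>x. f (c - x) = - f x"
  shows "integral {0..c} f = 0"
proof -
  have "integral {0..c} f = integral {-c..0} (\<lambda>x. f (- x))"
    using Henstock_Kurzweil_Integration.integral_reflect_real[of c 0 f] by simp
  also have "\<dots> = integral {-c..0} (\<lambda>x. - f (x + c))"
    using odd[of "x + c" for x] by (intro integral_cong) simp
  also have "\<dots> = - integral {-c..0} (f \<circ> (\<lambda>x. x + c))"
    by (simp add: o_def)
  also have "integral {-c..0} (f \<circ> (\<lambda>x. x + c)) = integral {-c + c..0 + c} f"
    by (rule integral_shift) (rule continuous_on_subset[OF f], simp)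
  finally show ?thesis by simp
qed


section \<open>Concave moduli of continuity\<close>

lemma
  assumes "\<omega> \<in> concave_moduli"
  shows concave_moduli_zero: "\<omega> 0 = 0"
    and concave_moduli_nonneg: "\<And>t. 0 \<le> t \<Longrightarrow> 0 \<le> \<omega> t"
    and concave_moduli_mono: "\<And>s t. 0 \<le> s \<Longrightarrow> s \<le> t \<Longrightarrow> \<omega> s \<le> \<omega> t"
    and concave_moduli_continuous: "continuous_on {0..} \<omega>"
  using assms by (auto simp: concave_moduli_def mono_on_def)

text \<open>
  Concavity together with \<open>\<omega> 0 = 0\<close>: the slopes \<open>\<omega> t / t\<close> of the chords from the origin
  decrease. Positivity, scaling and subadditivity are all consequences. The slopes are multiplied
  out so that no division by zero arises.
\<close>

lemma concave_moduli_chord: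
  assumes "\<omega> \<in> concave_moduli" "0 \<le> s" "s \<le> t"
  shows "s * \<omega> t \<le> t * \<omega> s"
proof (cases "t = 0")
  case False
  then have t: "t > 0" using assms by simp
  have "concave_on {0..} \<omega>" using assms(1) by (simp add: concave_moduli_def)
  from concave_onD[OF this, of "s / t" 0 t]
  have "(s / t) * \<omega> t \<le> \<omega> s"
    using assms t by (simp add: concave_moduli_zero)
  then show ?thesis using t by (simp add: field_simps)
qed (use assms in \<open>auto simp: concave_moduli_zero\<close>)

lemma concave_moduli_pos:
  assumes "\<omega> \<in> concave_moduli" "0 < t"
  shows "0 < \<omega> t"
proof (rule ccontr)
  assume "\<not> 0 < \<omega> t"
  then have t0: "\<omega> t = 0"
    using concave_moduli_nonneg[OF assms(1), of t] assms(2) by simp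
  obtain u where u: "u \<ge> 0" "\<omega> u \<noteq> 0"
    using assms(1) by (auto simp: concave_moduli_def)
  show False
  proof (cases "u \<le> t")
    case True
    then show False
      using concave_moduli_mono[OF assms(1) u(1) True] concave_moduli_nonneg[OF assms(1) u(1)] t0 u
      by simp
  next
    case False
    then have "t * \<omega> u \<le> 0"
      using concave_moduli_chord[OF assms(1), of t u] assms(2) t0 by simp
    then show False
      using concave_moduli_nonneg[OF assms(1) u(1)] u assms(2) by (simp add: mult_le_0_iff)
  qed
qed

lemma concave_moduli_scale:
  assumes "\<omega> \<in> concave_moduli" "1 \<le> L" "0 \<le> t"
  shows "\<omega> (L * t) \<le> L * \<omega> t"
proof (cases "t = 0")
  case False
  have "t * \<omega> (L * t) \<le> (L * t) * \<omega> t"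
    using assms by (intro concave_moduli_chord) (auto simp: mult_le_cancel_right1)
  then show ?thesis using False assms(3) by simp
qed (use assms in \<open>simp add: concave_moduli_zero\<close>)

lemma concave_moduli_subadditive:
  assumes "\<omega> \<in> concave_moduli" "0 \<le> s" "0 \<le> t"
  shows "\<omega> (s + t) \<le> \<omega> s + \<omega> t"
proof (cases "s + t = 0")
  case False
  have "s * \<omega> (s + t) \<le> (s + t) * \<omega> s" "t * \<omega> (s + t) \<le> (s + t) * \<omega> t"
    using assms by (auto intro!: concave_moduli_chord)
  then have "(s + t) * \<omega> (s + t) \<le> (s + t) * (\<omega> s + \<omega> t)"
    by (simp add: algebra_simps)
  then show ?thesis using False assms by (simp add: mult_le_cancel_left)
qed (use assms in \<open>auto simp: concave_moduli_zero add_nonneg_eq_0_iff\<close>)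

text \<open>
  Monotonicity and subadditivity make \<open>\<omega>\<close> a modulus of continuity of itself.
\<close>

lemma concave_moduli_diff:
  assumes "\<omega> \<in> concave_moduli" "0 \<le> s" "0 \<le> t"
  shows "\<bar>\<omega> s - \<omega> t\<bar> \<le> \<omega> \<bar>s - t\<bar>"
proof -
  have *: "\<bar>\<omega> s - \<omega> t\<bar> \<le> \<omega> \<bar>s - t\<bar>" if "0 \<le> s" "s \<le> t" for s t
    using concave_moduli_subadditive[OF assms(1), of s "t - s"]
      concave_moduli_mono[OF assms(1), of s t] that by simp
  show ?thesis
    using *[of s t] *[of t s] assms(2,3) by (cases "s \<le> t") (simp_all add: abs_minus_commute)
qed

lemma concave_moduli_comparison:
  assumes "\<omega> \<in> concave_moduli" "1 \<le> L" "0 \<le> r" "r \<le> L * t" "0 \<le> t"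
  shows "\<omega> r \<le> L * \<omega> t"
  using concave_moduli_mono[OF assms(1,3,4)] concave_moduli_scale[OF assms(1,2,5)] by simp

lemma continuous_on_of_modulus:
  fixes f :: "'a::metric_space \<Rightarrow> real"
  assumes \<omega>: "\<omega> \<in> concave_moduli" and C: "0 \<le> C"
    and f: "\<And>x y. \<bar>f x - f y\<bar> \<le> C * \<omega> (dist x y)"
  shows "continuous_on UNIV f"
  unfolding continuous_on_iff
proof (intro ballI allI impI)
  fix x and e :: real assume e: "e > 0"
  have "0 < e / (C + 1)" using e C by simp
  from concave_moduli_continuous[OF \<omega>, unfolded continuous_on_iff, rule_format, OF _ this, of 0]
  obtain d where d0: "d > 0"
    "\<And>t. t \<in> {0..} \<Longrightarrow> dist t 0 < d \<Longrightarrow> dist (\<omega> t) (\<omega> 0) < e / (C + 1)"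
    by auto
  have d: "d > 0" "\<And>t. 0 \<le> t \<Longrightarrow> t < d \<Longrightarrow> \<omega> t < e / (C + 1)"
  proof -
    show "d > 0" by (rule d0(1))
    fix t :: real assume "0 \<le> t" "t < d"
    then show "\<omega> t < e / (C + 1)"
      using d0(2)[of t] concave_moduli_zero[OF \<omega>] by (simp add: dist_real_def)
  qed
  have "dist (f y) (f x) < e" if "dist y x < d" for y
  proof -
    have "\<bar>f y - f x\<bar> \<le> C * \<omega> (dist y x)" by (rule f)
    also have "\<dots> \<le> (C + 1) * \<omega> (dist y x)"
      using concave_moduli_nonneg[OF \<omega>, of "dist y x"] by (simp add: algebra_simps)
    also have "\<dots> < e"
      using d(2)[of "dist y x"] that C by (simp add: field_simps)
    finally show ?thesis by (simp add: dist_real_def)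
  qed
  then show "\<exists>d>0. \<forall>x'\<in>UNIV. dist x' x < d \<longrightarrow> dist (f x') (f x) < e"
    using d(1) by blast
qed

text \<open>
  The factor \<open>1/2\<close> pays for the strict inequality \<open>dist x y < t\<close> in the canonical modulus: the
  lower bound is applied at \<open>t / 2\<close>, and \<open>\<omega> t \<le> 2 \<omega> (t / 2)\<close>.
\<close>

lemma canonical_modulus_sandwich:
  fixes f :: "'a::metric_space \<Rightarrow> real"
  assumes \<omega>: "\<omega> \<in> concave_moduli" and C: "0 < C"
    and upper: "\<And>x y. x \<in> X \<Longrightarrow> y \<in> X \<Longrightarrow> \<bar>f x - f y\<bar> \<le> C * \<omega> (dist x y)"
    and lower: "\<And>s. 0 < s \<Longrightarrow> s \<le> s0 \<Longrightarrow>
      \<exists>x\<in>X. \<exists>y\<in>X. dist x y \<le> s \<and> c * \<omega> s \<le> \<bar>f x - f y\<bar>" and c: "0 < c"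
    and t: "0 < t" "t \<le> s0"
  shows "c / 2 * \<omega> t \<le> canonical_modulus X f t" "canonical_modulus X f t \<le> C * \<omega> t"
proof -
  let ?S = "{\<bar>f x - f y\<bar> | x y. x \<in> X \<and> y \<in> X \<and> dist x y < t}"
  have le: "z \<le> C * \<omega> t" if z: "z \<in> ?S" for z
  proof -
    obtain x y where xy: "z = \<bar>f x - f y\<bar>" "x \<in> X" "y \<in> X" "dist x y < t"
      using z by blast
    have "\<omega> (dist x y) \<le> \<omega> t"
      using xy(4) by (intro concave_moduli_mono[OF \<omega>]) auto
    then have "C * \<omega> (dist x y) \<le> C * \<omega> t" using C by simp
    then show ?thesis using upper[OF xy(2,3)] xy(1) by simp
  qed
  obtain x y where xy: "x \<in> X" "y \<in> X" "dist x y \<le> t / 2" "c * \<omega> (t / 2) \<le> \<bar>f x - f y\<bar>"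
    using lower[of "t / 2"] t by auto
  have mem: "\<bar>f x - f y\<bar> \<in> ?S"
    using xy t by (intro CollectI exI[of _ x] exI[of _ y]) auto
  have "\<omega> t \<le> 2 * \<omega> (t / 2)"
    using concave_moduli_scale[OF \<omega>, of 2 "t / 2"] t by simp
  then have "c / 2 * \<omega> t \<le> c * \<omega> (t / 2)" using c by simp
  also have "\<dots> \<le> \<bar>f x - f y\<bar>" by (rule xy(4))
  also have "\<dots> \<le> Sup ?S"
    using le by (intro cSup_upper[OF mem]) (auto simp: bdd_above_def)
  finally show "c / 2 * \<omega> t \<le> canonical_modulus X f t"
    using t by (simp add: canonical_modulus_def)
  show "canonical_modulus X f t \<le> C * \<omega> t"
    using cSup_least[of ?S "C * \<omega> t"] mem le t by (auto simp: canonical_modulus_def)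
qed

lemma modulus_equivI:
  assumes "\<And>t. 0 < t \<Longrightarrow> t \<le> t0 \<Longrightarrow> 0 < \<omega> t" "0 < t0" "0 < c" "0 < C"
    and "\<And>t. 0 < t \<Longrightarrow> t \<le> t0 \<Longrightarrow> c * \<omega> t \<le> \<eta> t \<and> \<eta> t \<le> C * \<omega> t"
  shows "\<eta> \<simeq>\<^sub>m \<omega>" "\<omega> \<simeq>\<^sub>m \<eta>"
proof -
  show "\<eta> \<simeq>\<^sub>m \<omega>"
    unfolding modulus_equiv_def
    by (rule exI[of _ t0], rule conjI[OF assms(2)], rule exI[of _ c], rule conjI[OF assms(3)],
        rule exI[of _ C]) (use assms in \<open>auto simp: field_simps\<close>)
  have "1 / C \<le> \<omega> t / \<eta> t \<and> \<omega> t / \<eta> t \<le> 1 / c" if t: "t \<in> {0<..t0}" for t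
  proof -
    have "0 < c * \<omega> t" using assms(1,3) t by simp
    then have "0 < \<eta> t" using assms(5)[of t] t by simp
    then show ?thesis using assms(3-5) t by (auto simp: field_simps)
  qed
  then show "\<omega> \<simeq>\<^sub>m \<eta>"
    unfolding modulus_equiv_def using assms(2-4) by (metis zero_less_divide_1_iff)
qed

lemma canonical_modulus_equivI:
  fixes f :: "'a::metric_space \<Rightarrow> real"
  assumes \<omega>: "\<omega> \<in> concave_moduli" and "0 < C"
    and "\<And>x y. x \<in> X \<Longrightarrow> y \<in> X \<Longrightarrow> \<bar>f x - f y\<bar> \<le> C * \<omega> (dist x y)"
    and "0 < c" "0 < s0"
    and "\<And>s. 0 < s \<Longrightarrow> s \<le> s0 \<Longrightarrow>
      \<exists>x\<in>X. \<exists>y\<in>X. dist x y \<le> s \<and> c * \<omega> s \<le> \<bar>f x - f y\<bar>"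
  shows "canonical_modulus X f \<simeq>\<^sub>m \<omega>" "\<omega> \<simeq>\<^sub>m canonical_modulus X f"
proof -
  have b: "c / 2 * \<omega> t \<le> canonical_modulus X f t \<and> canonical_modulus X f t \<le> C * \<omega> t"
    if "0 < t" "t \<le> s0" for t
    using canonical_modulus_sandwich[OF assms(1,2,3,6,4) that] by blast
  show "canonical_modulus X f \<simeq>\<^sub>m \<omega>" "\<omega> \<simeq>\<^sub>m canonical_modulus X f"
    using modulus_equivI[of s0 \<omega> "c / 2" C "canonical_modulus X f"] b
      concave_moduli_pos[OF \<omega>] assms(2,4,5) by auto
qed


section \<open>Circle maps and their lifts\<close>

lemma circle_of_add_int: "n \<in> \<int> \<Longrightarrow> circle_of (x + n) = circle_of x"
  by (simp add: circle_of_eq_iff)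

lemma dist_circle_of_le: "dist (circle_of x) (circle_of y) \<le> \<bar>x - y\<bar>"
  using infdist_le[of 0 \<int> "x - y"] by (simp add: dist_circle_of dist_real_def)

text \<open>
  The distance on the circle is attained by representatives, which reduces metric estimates on
  the circle to estimates on the line.
\<close>

lemma circle_nearest_representative:
  obtains y where "q = circle_of y" "\<bar>x - y\<bar> = dist (circle_of x) q"
proof -
  obtain y0 where y0: "q = circle_of y0" using circle_of_surj by blast
  have "(\<int> :: real set) \<noteq> {}" using Ints_0 by blast
  then obtain n where n: "n \<in> \<int>" "infdist (x - y0) \<int> = dist (x - y0) n"
    using infdist_attains_inf[OF closed_Ints] by blast
  show thesis
  proof
    show "q = circle_of (y0 + n)" using y0 circle_of_add_int[OF n(1)] by simp
    show "\<bar>x - (y0 + n)\<bar> = dist (circle_of x) q"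
      using n(2) y0 by (simp add: dist_circle_of dist_real_def algebra_simps)
  qed
qed

text \<open>
  The last argument of \<open>P\<close> stands for the distance: a bound in terms of \<open>\<bar>x - y\<bar>\<close> for all
  representatives holds in particular for nearest ones.
\<close>

lemma circle_dist_boundI:
  assumes "\<And>x y. P (circle_of x) (circle_of y) \<bar>x - y\<bar>"
  shows "P p q (dist p q)"
proof -
  obtain x where x: "p = circle_of x" using circle_of_surj by blast
  obtain y where y: "q = circle_of y" "\<bar>x - y\<bar> = dist (circle_of x) q"
    using circle_nearest_representative .
  show ?thesis using assms[of x y] x y by simp
qed

text \<open>
  The hypotheses say that \<open>x - y\<close> stays at least \<open>c\<close> away from \<open>0\<close> and from \<open>1\<close>, and then it
  does so from every integer.
\<close>

lemma circle_dist_ge: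
  assumes "c \<le> x - y" "x - y \<le> 1 - c"
  shows "c \<le> dist (circle_of x) (circle_of y)"
proof -
  obtain y' where y': "circle_of y = circle_of y'" "\<bar>x - y'\<bar> = dist (circle_of x) (circle_of y)"
    using circle_nearest_representative .
  then obtain n where n: "y - y' = of_int n" unfolding circle_of_eq_iff by (elim Ints_cases)
  have "c \<le> \<bar>x - y'\<bar>"
  proof (cases "n \<ge> 0")
    case True
    then have "0 \<le> real_of_int n" by simp
    then show ?thesis using n assms by linarith
  next
    case False
    then have "real_of_int n \<le> -1" by linarith
    then show ?thesis using n assms by linarith
  qed
  then show ?thesis using y'(2) by simp
qed

lemma dist_circle_of_short:
  assumes "\<bar>x - y\<bar> \<le> 1/2"
  shows "dist (circle_of x) (circle_of y) = \<bar>x - y\<bar>"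
proof (rule antisym)
  show "\<bar>x - y\<bar> \<le> dist (circle_of x) (circle_of y)"
    using circle_dist_ge[of "x - y" x y] circle_dist_ge[of "y - x" y x] assms
    by (cases "y \<le> x") (auto simp: dist_commute)
qed (rule dist_circle_of_le)

text \<open>
  The value at an arbitrary representative; it is meaningful for functions with period \<open>1\<close>.
\<close>

definition descend :: "(real \<Rightarrow> 'a) \<Rightarrow> circle \<Rightarrow> 'a"
  where "descend F p = F (SOME x. circle_of x = p)"

lemma descend_circle_of:
  assumes "\<And>x n. F (x + of_int n) = F x"
  shows "descend F (circle_of x) = F x"
proof -
  have "circle_of (SOME y. circle_of y = circle_of x) = circle_of x"
    by (rule someI[of _ x]) simp
  then obtain n where "(SOME y. circle_of y = circle_of x) = x + of_int n"
    unfolding circle_of_eq_iff by (metis Ints_cases diff_add_cancel add.commute)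
  then show ?thesis using assms by (simp add: descend_def)
qed

lemma continuous_on_circle:
  fixes f :: "circle \<Rightarrow> 'a::metric_space"
  assumes f: "\<And>x. f (circle_of x) = F x" and F: "continuous_on UNIV F"
  shows "continuous_on UNIV f"
  unfolding continuous_on_iff
proof (intro ballI allI impI)
  fix p and e :: real assume e: "e > 0"
  obtain x where x: "p = circle_of x" using circle_of_surj by blast
  obtain d where d: "d > 0" "\<And>y. dist y x < d \<Longrightarrow> dist (F y) (F x) < e"
    using F e unfolding continuous_on_iff by (meson UNIV_I)
  have "dist (f q) (f p) < e" if q: "dist q p < d" for q
  proof -
    obtain y where y: "q = circle_of y" "\<bar>x - y\<bar> = dist (circle_of x) q"
      using circle_nearest_representative .
    have "dist y x < d" using y(2) q x by (simp add: dist_real_def dist_commute abs_minus_commute)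
    then show ?thesis using d(2)[of y] f x y(1) by simp
  qed
  then show "\<exists>d>0. \<forall>q\<in>UNIV. dist q p < d \<longrightarrow> dist (f q) (f p) < e"
    using d(1) by blast
qed


section \<open>The doubling map of a balanced density\<close>

text \<open>
  \<open>R\<close> is the periodic extension of a density on \<open>[0,1]\<close>. The constants \<open>m\<close> and \<open>M\<close> stand for
  bounds of \<open>R\<close> rather than for its extrema; they make the expansion constant explicit. The masses
  are normalised so that \<open>G\<close> fixes every half-integer, where the branches of the map meet.
\<close>

locale balanced_density =
  fixes R :: "real \<Rightarrow> real" and m M :: real
  assumes continuous_R: "continuous_on UNIV R"
    and R_shift_1: "R (x + 1) = R x"
    and R_lower: "m \<le> R x" and R_upper: "R x \<le> M"
    and half_less_m: "1/2 < m" and oscillation: "M < m + 1/2"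
    and R_0: "R 0 = 1"
    and left_mass: "integral {0..1/2} R = 1/2"
    and right_mass: "integral {1/2..1} R = 1/2"
begin

definition G :: "real \<Rightarrow> real"
  where "G x = integral {0..x} R - integral {x..0} R"

definition h :: "real \<Rightarrow> real"
  where "h y = G y - y / 2"

text \<open>
  The right branch of the map is \<open>W - 1\<close> on \<open>[1/2,1]\<close>; the shift by \<open>1\<close> is invisible on the
  circle.
\<close>

definition W :: "real \<Rightarrow> real"
  where "W x = inv h (G x)"

text \<open>
  The integer part of \<open>2 x\<close> is even exactly on the intervals \<open>[n, n + 1/2)\<close>.
\<close>

definition lift :: "real \<Rightarrow> real"
  where "lift x = (if even \<lfloor>2 * x\<rfloor> then 2 * G x else W x)"

definition W' :: "real \<Rightarrow> real"
  where "W' x = R x / (R (W x) - 1/2)"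

definition lift' :: "real \<Rightarrow> real"
  where "lift' x = (if even \<lfloor>2 * x\<rfloor> then 2 * R x else W' x)"

definition circle_map :: "circle \<Rightarrow> circle"
  where "circle_map = descend (circle_of \<circ> lift)"

lemma R_bounds: "m \<le> 1" "1 \<le> M" "0 < m" "0 < M - 1/2" "1/2 < R x" "0 < R x" "0 < R x - 1/2"
  using R_lower[of 0] R_upper[of 0] R_0 half_less_m R_lower[of x] by auto

lemma R_measurable [measurable]: "R \<in> borel_measurable borel"
  using continuous_R by (rule borel_measurable_continuous_onI)

lemma R_shift: "R (x + of_int n) = R x"
proof (induction n rule: int_induct[where k = 0])
  case (step1 i)
  then show ?case using R_shift_1[of "x + of_int i"] by (simp add: algebra_simps)
next
  case (step2 i)
  then show ?case using R_shift_1[of "x + of_int i - 1"] by (simp add: algebra_simps)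
qed simp

text \<open>
  To differentiate at a point of either sign, \<open>G\<close> is compared with the primitive that
  starts at a point far enough to the left.
\<close>

lemma G_has_derivative: "(G has_real_derivative R x) (at x)"
proof -
  define n where "n = \<bar>x\<bar> + 1"
  have cont: "continuous_on S R" for S using continuous_R continuous_on_subset by blast
  have int: "R integrable_on {a..b}" for a b
    by (rule integrable_continuous_real[OF cont])
  have eq: "G y = integral {-n..y} R - integral {-n..0} R" if "-n < y" for y
  proof (cases "0 \<le> y")
    case True
    have "integral {-n..0} R + integral {0..y} R = integral {-n..y} R"
      using True by (intro Henstock_Kurzweil_Integration.integral_combine int) (auto simp: n_def)
    moreover have "integral {y..0} R = 0"
      using True by (cases "y = 0") auto
    ultimately show ?thesis by (simp add: G_def)
  next
    case False
    have "integral {-n..y} R + integral {y..0} R = integral {-n..0} R"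
      using False that by (intro Henstock_Kurzweil_Integration.integral_combine int) auto
    then show ?thesis using False by (simp add: G_def)
  qed
  have x: "-n < x" "x < n" by (auto simp: n_def)
  have "((\<lambda>y. integral {-n..y} R) has_real_derivative R x) (at x within {-n..n})"
    using x by (intro integral_has_real_derivative cont) auto
  then have "((\<lambda>y. integral {-n..y} R) has_real_derivative R x) (at x)"
    using x at_within_Icc_at[of "-n" x n] by simp
  then have D: "((\<lambda>y. integral {-n..y} R - integral {-n..0} R) has_real_derivative R x) (at x)"
    using DERIV_diff[OF _ DERIV_const] by fastforce
  have "eventually (\<lambda>y. y \<in> {-n<..}) (nhds x)"
    using x by (intro eventually_nhds_in_open) auto
  then have "eventually (\<lambda>y. G y = integral {-n..y} R - integral {-n..0} R) (nhds x)"
    by eventually_elim (use eq in auto)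
  from DERIV_cong_ev[OF refl this refl] D show ?thesis by simp
qed

lemma G_eq_primitive: "0 \<le> x \<Longrightarrow> G x = primitive R x"
  by (cases "x = 0") (simp_all add: G_def primitive_def)

lemma G_0 [simp]: "G 0 = 0" by (simp add: G_def)

lemma G_half [simp]: "G (1/2) = 1/2" using left_mass by (simp add: G_def)

lemma G_1 [simp]: "G 1 = 1"
proof -
  have "R integrable_on {0..1}"
    by (rule integrable_continuous_real) (rule continuous_on_subset[OF continuous_R], simp)
  then have "integral {0..1/2} R + integral {1/2..1} R = integral {0..1} R"
    by (intro Henstock_Kurzweil_Integration.integral_combine) auto
  then show ?thesis using left_mass right_mass by (simp add: G_def)
qed

text \<open>
  The increment of \<open>G\<close> over an integer translation has derivative \<open>0\<close>, and over \<open>[0,1]\<close> it is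
  the total mass \<open>1\<close>.
\<close>

lemma G_shift: "G (x + of_int n) = G x + of_int n"
proof -
  have "((\<lambda>y. G (y + of_int n) - G y) has_real_derivative 0) (at y)" for y n
  proof -
    have "((\<lambda>y. G (y + of_int n)) has_real_derivative R (y + of_int n)) (at y)"
      using DERIV_shift[of G "R (y + of_int n)" y "of_int n"] G_has_derivative by simp
    from DERIV_diff[OF this G_has_derivative[of y]] show ?thesis by (simp add: R_shift)
  qed
  then have "G (x + of_int n) - G x = G (0 + of_int n) - G 0" for x n
    using DERIV_isconst_all[of "\<lambda>y. G (y + of_int n) - G y" x 0] by blast
  then have const: "G (x + of_int n) = G x + G (of_int n)" for x n
    by (simp add: algebra_simps)
  have "G (of_int n) = of_int n"
  proof (induction n rule: int_induct[where k = 0])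
    case (step1 i)
    then show ?case using const[of "of_int i" 1] by simp
  next
    case (step2 i)
    then show ?case using const[of "of_int (i - 1)" 1] by simp
  qed simp
  then show ?thesis using const by simp
qed

lemma G_half_int: "G (of_int k / 2) = of_int k / 2"
proof (cases "even k")
  case True
  then obtain n where "k = 2 * n" by (rule evenE)
  then show ?thesis using G_shift[of 0 n] by simp
next
  case False
  then obtain n where n: "k = 2 * n + 1" by (rule oddE)
  then have "of_int k / 2 = 1/2 + real_of_int n" by simp
  then show ?thesis using G_shift[of "1/2" n] by (simp only: G_half)
qed

lemma G_increment:
  assumes "x \<le> y"
  shows "m * (y - x) \<le> G y - G x" "G y - G x \<le> M * (y - x)"
proof -
  have "\<exists>z. G y - G x = (y - x) * R z"
  proof (cases "x = y")
    case False
    then have "x < y" using assms by simp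
    from MVT2[OF this, of G R] G_has_derivative show ?thesis by blast
  qed simp
  then obtain z where z: "G y - G x = (y - x) * R z" by blast
  show "m * (y - x) \<le> G y - G x" "G y - G x \<le> M * (y - x)"
    using z assms R_lower[of z] R_upper[of z] by (simp_all add: mult.commute mult_right_mono)
qed

lemma h_has_derivative: "(h has_real_derivative R x - 1/2) (at x)"
  unfolding h_def [abs_def] by (rule derivative_eq_intros G_has_derivative refl | simp)+

lemma h_increment:
  assumes "x \<le> y"
  shows "(m - 1/2) * (y - x) \<le> h y - h x"
  using G_increment(1)[OF assms] by (simp add: h_def field_simps)

text \<open>
  As \<open>R \<ge> m > 1/2\<close>, the function \<open>h\<close> expands distances by a fixed positive factor, so its
  inverse is Lipschitz and in particular continuous.
\<close>

lemma h_expands: "(m - 1/2) * \<bar>x - y\<bar> \<le> \<bar>h x - h y\<bar>"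
  using h_increment[of x y] h_increment[of y x] by (cases "x \<le> y") (auto simp: abs_if)

lemma h_strict_mono: "x < y \<Longrightarrow> h x < h y"
  using h_increment[of x y] mult_pos_pos[of "m - 1/2" "y - x"] half_less_m by linarith

lemma h_int: "h (of_int k) = of_int k / 2"
  using G_shift[of 0 k] by (simp add: h_def)

lemma h_shift: "h (x + of_int n) = h x + of_int n / 2"
  by (simp add: h_def G_shift add_divide_distrib)

text \<open>
  At integers \<open>h\<close> takes the half-integer values, so every real number lies between two values
  of \<open>h\<close> at consecutive integers.
\<close>

lemma bij_h: "bij h"
proof (rule bijI)
  show "inj h"
    by (rule strict_mono_imp_inj_on) (simp add: strict_mono_def h_strict_mono)
  show "surj h"
    unfolding surj_def
  proof
    fix u :: real
    define k where "k = \<lfloor>2 * u\<rfloor>"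
    have "of_int k \<le> 2 * u" "2 * u \<le> of_int (k + 1)"
      unfolding k_def by linarith+
    then have "h (of_int k) \<le> u" "u \<le> h (of_int (k + 1))"
      unfolding h_int by simp_all
    moreover have "\<forall>x. of_int k \<le> x \<and> x \<le> of_int (k + 1) \<longrightarrow> isCont h x"
      using h_has_derivative DERIV_isCont by blast
    moreover have "real_of_int k \<le> of_int (k + 1)" by simp
    ultimately obtain x where "h x = u"
      using IVT[of h "of_int k" u "of_int (k + 1)"] by blast
    then show "\<exists>x. u = h x" by blast
  qed
qed

lemma inv_h_h [simp]: "inv h (h x) = x"
  using bij_h by (simp add: bij_is_inj)

lemma h_inv_h [simp]: "h (inv h u) = u"
  using bij_h by (simp add: bij_is_surj surj_f_inv_f)

lemma h_W: "h (W x) = G x" by (simp add: W_def)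

lemma W_eqI: "h y = G x \<Longrightarrow> W x = y"
  unfolding W_def by (metis inv_h_h)

lemma inv_h_lipschitz: "\<bar>inv h u - inv h v\<bar> \<le> \<bar>u - v\<bar> / (m - 1/2)"
  using h_expands[of "inv h u" "inv h v"] half_less_m by (simp add: field_simps)

lemma inv_h_has_derivative: "(inv h has_real_derivative inverse (R (inv h u) - 1/2)) (at u)"
proof (rule DERIV_inverse_function[where f = h and a = "u - 1" and b = "u + 1"])
  show "isCont (inv h) u"
  proof -
    have "(1 / (m - 1/2))-lipschitz_on UNIV (inv h)"
      using inv_h_lipschitz half_less_m by (auto simp: lipschitz_on_def dist_real_def)
    then show ?thesis using lipschitz_on_continuous_on continuous_on_eq_continuous_at by blast
  qed
  show "R (inv h u) - 1 / 2 \<noteq> 0" using R_bounds(7)[of "inv h u"] by simp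
qed (use h_has_derivative in auto)

lemma W_has_derivative: "(W has_real_derivative W' x) (at x)"
proof -
  have "((\<lambda>x. inv h (G x)) has_real_derivative inverse (R (inv h (G x)) - 1/2) * R x) (at x)"
    by (rule DERIV_chain2[OF inv_h_has_derivative G_has_derivative])
  then show ?thesis by (simp add: W_def [abs_def] W'_def field_simps)
qed

lemma W_half_int: "W (of_int k / 2) = of_int k"
  by (rule W_eqI) (simp add: h_int G_half_int)

lemma W_shift: "W (x + of_int n) = W x + 2 * of_int n"
  by (rule W_eqI) (use h_shift[of "W x" "2 * n"] in \<open>simp add: h_W G_shift\<close>)

text \<open>
  At a half-integer \<open>x\<close> the value \<open>W x\<close> is an integer, where \<open>R\<close> equals \<open>1\<close>; thus the
  denominator of \<open>W' x\<close> is \<open>1/2\<close> and the one-sided derivatives of the two branches agree.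
\<close>

lemma W'_half_int: "W' (of_int k / 2) = 2 * R (of_int k / 2)"
  using R_shift[of 0 k] R_0 by (simp add: W'_def W_half_int)

lemma floor_double_shift: "\<lfloor>2 * (x + real_of_int n)\<rfloor> = \<lfloor>2 * x\<rfloor> + 2 * n"
proof -
  have "2 * (x + real_of_int n) = 2 * x + of_int (2 * n)" by simp
  then show ?thesis by (simp only: floor_add_int[symmetric])
qed

lemma lift_shift: "lift (x + of_int n) = lift x + 2 * of_int n"
  unfolding lift_def floor_double_shift by (simp add: G_shift W_shift)

lemma lift_half_int: "lift (of_int k / 2) = of_int k"
  by (simp add: lift_def G_half_int W_half_int)

lemma lift'_half_int: "lift' (of_int k / 2) = 2 * R (of_int k / 2)"
  by (simp add: lift'_def W'_half_int)

lemma double_G_has_derivative: "((\<lambda>x. 2 * G x) has_real_derivative 2 * R x) (at x)"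
  using DERIV_cmult[OF G_has_derivative] .

text \<open>
  Away from the half-integers the lift coincides locally with one branch; at a half-integer both
  branches have the same value and the same derivative.
\<close>

lemma lift_has_derivative: "(lift has_real_derivative lift' x) (at x)"
proof (cases "2 * x \<in> \<int>")
  case True
  then obtain k where k: "2 * x = of_int k" by (elim Ints_cases)
  then have x: "x = of_int k / 2" by simp
  show ?thesis
  proof (rule has_real_derivative_switch)
    show "((\<lambda>x. 2 * G x) has_real_derivative lift' x) (at x)"
      using double_G_has_derivative[of x] by (simp add: x lift'_half_int)
    show "(W has_real_derivative lift' x) (at x)"
      using W_has_derivative[of x] by (simp add: x lift'_half_int W'_half_int)
  qed (auto simp: lift_def x G_half_int W_half_int)
next
  case False
  have "((\<lambda>y. 2 * y) \<longlongrightarrow> 2 * x) (nhds x)"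
    by (intro tendsto_intros filterlim_ident)
  from eventually_floor_eq[OF this] False
  have ev: "\<forall>\<^sub>F y in nhds x. \<lfloor>2 * y\<rfloor> = \<lfloor>2 * x\<rfloor>" by simp
  show ?thesis
  proof (cases "even \<lfloor>2 * x\<rfloor>")
    case True
    from ev have "\<forall>\<^sub>F y in nhds x. lift y = 2 * G y"
      by eventually_elim (use True in \<open>simp add: lift_def\<close>)
    from DERIV_cong_ev[OF refl this refl] show ?thesis
      using double_G_has_derivative[of x] True by (simp add: lift'_def)
  next
    case False
    from ev have "\<forall>\<^sub>F y in nhds x. lift y = W y"
      by eventually_elim (use False in \<open>simp add: lift_def\<close>)
    from DERIV_cong_ev[OF refl this refl] show ?thesis
      using W_has_derivative[of x] False by (simp add: lift'_def)
  qed
qed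

lemma continuous_on_G: "continuous_on S G"
  by (rule DERIV_continuous_on) (rule has_field_derivative_at_within[OF G_has_derivative])

lemma continuous_on_W: "continuous_on S W"
  by (rule DERIV_continuous_on) (rule has_field_derivative_at_within[OF W_has_derivative])

lemma continuous_on_lift: "continuous_on S lift"
  by (rule DERIV_continuous_on) (rule has_field_derivative_at_within[OF lift_has_derivative])

lemma W'_lower: "m / (M - 1/2) \<le> W' x"
  unfolding W'_def using R_lower[of x] R_upper[of "W x"] R_bounds(7)[of "W x"] R_bounds(3)
  by (intro frac_le) auto

lemma W'_upper: "W' x \<le> M / (m - 1/2)"
  unfolding W'_def using R_upper[of x] R_lower[of "W x"] half_less_m R_bounds(2)
  by (intro frac_le) auto

text \<open>
  On the left branch the derivative is at least \<open>2 m\<close>, which is not below \<open>m / (M - 1/2)\<close> because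
  \<open>M \<ge> R 0 = 1\<close>. The common bound \<open>m / (M - 1/2)\<close> is larger than \<open>1\<close> because \<open>M - m < 1/2\<close>.
\<close>

lemma lift'_lower: "m / (M - 1/2) \<le> lift' x"
proof -
  have "m / (M - 1/2) \<le> 2 * m"
    using R_bounds mult_left_mono[of "1" "2 * (M - 1/2)" m] by (simp add: field_simps)
  then show ?thesis using W'_lower[of x] R_lower[of x] by (simp add: lift'_def)
qed

lemma circle_map_circle_of: "circle_map (circle_of x) = circle_of (lift x)"
proof -
  have "circle_of (lift (x + of_int n)) = circle_of (lift x)" for x n
    unfolding lift_shift by (rule circle_of_add_int) simp
  then show ?thesis unfolding circle_map_def by (subst descend_circle_of) auto
qed

lemma continuous_on_circle_map: "continuous_on UNIV circle_map"
proof (rule continuous_on_circle)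
  show "circle_map (circle_of x) = circle_of (lift x)" for x
    by (rule circle_map_circle_of)
  show "continuous_on UNIV (\<lambda>x. circle_of (lift x))"
    using continuous_on_compose[OF continuous_on_lift continuous_on_circle_of] by (simp add: o_def)
qed

lemma has_circle_deriv_circle_map: "has_circle_deriv circle_map (lift' x) (circle_of x)"
  unfolding has_circle_deriv_def
  using circle_map_circle_of lift_has_derivative by metis

lemma circle_deriv_circle_map: "circle_deriv circle_map (circle_of x) = lift' x"
  by (rule circle_deriv_eq[OF has_circle_deriv_circle_map])


section \<open>The two branches on the unit interval\<close>

lemma lift_left:
  assumes "x \<in> {0..1/2}"
  shows "lift x = 2 * G x"
proof (cases "x = 1/2")
  case True
  show ?thesis unfolding True using lift_half_int[of 1] by simp
next
  case False
  then have "\<lfloor>2 * x\<rfloor> = 0" using assms by (intro floor_unique) auto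
  then show ?thesis by (simp add: lift_def)
qed

lemma lift_right:
  assumes "x \<in> {1/2..1}"
  shows "lift x = W x"
proof (cases "x = 1")
  case True
  show ?thesis unfolding True using lift_half_int[of 2] W_half_int[of 2] by simp
next
  case False
  then have "\<lfloor>2 * x\<rfloor> = 1" using assms by (intro floor_unique) auto
  then show ?thesis by (simp add: lift_def)
qed

lemma lift'_left:
  assumes "x \<in> {0..1/2}"
  shows "lift' x = 2 * R x"
proof (cases "x = 1/2")
  case True
  show ?thesis unfolding True using lift'_half_int[of 1] by simp
next
  case False
  then have "\<lfloor>2 * x\<rfloor> = 0" using assms by (intro floor_unique) auto
  then show ?thesis by (simp add: lift'_def)
qed

lemma G_strict_mono: "x < y \<Longrightarrow> G x < G y"
  using G_increment(1)[of x y] mult_pos_pos[of m "y - x"] R_bounds(3) by linarith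

lemma W_strict_mono: "x < y \<Longrightarrow> W x < W y"
  using G_strict_mono[of x y] h_W[of x] h_W[of y] h_strict_mono[of "W y" "W x"]
  by (metis less_asym linorder_neqE_linordered_idom less_irrefl)

lemma W_mono: "x \<le> y \<Longrightarrow> W x \<le> W y"
  using W_strict_mono[of x y] by (cases "x = y") auto

lemma W_half [simp]: "W (1/2) = 1" and W_1 [simp]: "W 1 = 2"
  using W_half_int[of 1] W_half_int[of 2] by simp_all

text \<open>
  Both sides are the point of \<open>[0,1]\<close> that \<open>h\<close> maps to \<open>G x - 1/2\<close>.
\<close>

lemma right_branch_eq:
  assumes "x \<in> {1/2..1}"
  shows "right_branch R x = W x - 1"
  unfolding right_branch_def
proof (rule inv_into_f_eq)
  have prim: "primitive R y - y / 2 = h y" if "y \<in> {0..1}" for y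
    using that by (simp add: h_def G_eq_primitive)
  have "inj_on h {0..1}" using bij_h by (simp add: bij_def inj_on_def)
  then show "inj_on (\<lambda>y. primitive R y - y / 2) {0..1}"
    using inj_on_cong[of "{0..1}" h] prim by fastforce
  have "W (1/2) \<le> W x" "W x \<le> W 1"
    using assms by (auto intro!: W_mono simp del: W_half W_1)
  then show mem: "W x - 1 \<in> {0..1}" by simp
  show "primitive R (W x - 1) - (W x - 1) / 2 = primitive R x - 1/2"
    using prim[OF mem] h_shift[of "W x" "-1"] assms by (simp add: h_W G_eq_primitive)
qed

lemma represented_by_branches: "represented_by (left_branch R) (right_branch R) circle_map"
proof -
  have contG: "continuous_on S (\<lambda>x. 2 * G x)" and contW: "continuous_on S (\<lambda>x. W x - 1)" for S
    by (intro continuous_intros continuous_on_G continuous_on_W)+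
  have left: "left_branch R x = 2 * G x" if "x \<in> {0..1/2}" for x
    using that by (simp add: left_branch_def G_eq_primitive)
  have "left_branch R ` {0..1/2} = (\<lambda>x. 2 * G x) ` {0..1/2}"
    using left by (intro image_cong) auto
  also have "\<dots> = {2 * G 0..2 * G (1/2)}"
    using G_strict_mono by (intro strict_mono_image_Icc contG) auto
  finally have im1: "left_branch R ` {0..1/2} = {0..1}" by simp
  have "right_branch R ` {1/2..1} = (\<lambda>x. W x - 1) ` {1/2..1}"
    using right_branch_eq by (intro image_cong) auto
  also have "\<dots> = {W (1/2) - 1..W 1 - 1}"
    using W_strict_mono by (intro strict_mono_image_Icc contW) (auto simp del: W_half W_1)
  finally have im2: "right_branch R ` {1/2..1} = {0..1}" by simp
  have "circle_of (W x - 1) = circle_of (W x)" for x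
    using circle_of_add_int[of "-1" "W x"] by simp
  then show ?thesis
    unfolding represented_by_def
    using im1 im2 left G_strict_mono W_strict_mono
    by (auto simp: strict_mono_on_def right_branch_eq circle_map_circle_of lift_left lift_right)
qed


section \<open>Moduli of continuity of the density and of the derivative\<close>

lemma W_lipschitz: "\<bar>W x - W y\<bar> \<le> M / (m - 1/2) * \<bar>x - y\<bar>"
proof -
  have "\<bar>W' z\<bar> \<le> M / (m - 1/2)" for z
  proof -
    have "0 < W' z" using R_bounds(6)[of z] R_bounds(7)[of "W z"] by (simp add: W'_def)
    then show ?thesis using W'_upper[of z] by simp
  qed
  then have "norm (W x - W y) \<le> M / (m - 1/2) * norm (x - y)"
    using W_has_derivative by (intro field_differentiable_bound[of UNIV W W']) auto
  then show ?thesis by simp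
qed

text \<open>
  The numerator \<open>R x\<close> varies by at most \<open>C \<omega> t\<close> and the denominator \<open>R (W x) - 1/2\<close> by at most
  \<open>C L \<omega> t\<close>, where \<open>L\<close> is a Lipschitz constant of \<open>W\<close>; the denominator is bounded below by
  \<open>m - 1/2\<close>.
\<close>

lemma W'_modulus:
  assumes \<omega>: "\<omega> \<in> concave_moduli" and C: "0 < C"
    and R: "\<And>x y. \<bar>R x - R y\<bar> \<le> C * \<omega> \<bar>x - y\<bar>"
  shows "\<exists>K>0. \<forall>x y. \<bar>W' x - W' y\<bar> \<le> K * \<omega> \<bar>x - y\<bar>"
proof -
  define k where "k = m - 1/2"
  define L where "L = M / k"
  have k: "0 < k" "k \<le> 1" using half_less_m R_bounds(1) by (auto simp: k_def)
  have L: "1 \<le> L" using k R_bounds(2) by (simp add: L_def)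
  have bound: "\<bar>W' x - W' y\<bar> \<le> (C / k + M * (C * L) / (k * k)) * \<omega> \<bar>x - y\<bar>" for x y
  proof -
    define s t where "s = R (W x) - 1/2" and "t = R (W y) - 1/2"
    have st: "k \<le> s" "k \<le> t" using R_lower by (auto simp: s_def t_def k_def)
    have "\<omega> \<bar>W x - W y\<bar> \<le> L * \<omega> \<bar>x - y\<bar>"
      using W_lipschitz[of x y] L by (intro concave_moduli_comparison[OF \<omega>]) (auto simp: L_def k_def)
    then have "C * \<omega> \<bar>W x - W y\<bar> \<le> C * (L * \<omega> \<bar>x - y\<bar>)" using C by simp
    then have ts: "\<bar>t - s\<bar> \<le> C * L * \<omega> \<bar>x - y\<bar>"
      using R[of "W y" "W x"] by (simp add: s_def t_def abs_minus_commute)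
    have "W' x - W' y = (R x - R y) / s + R y * (t - s) / (s * t)"
      using st k unfolding W'_def s_def[symmetric] t_def[symmetric] by (simp add: field_simps)
    then have "\<bar>W' x - W' y\<bar> \<le> \<bar>(R x - R y) / s\<bar> + \<bar>R y * (t - s) / (s * t)\<bar>"
      by (simp only: abs_triangle_ineq)
    also have "\<bar>(R x - R y) / s\<bar> \<le> C * \<omega> \<bar>x - y\<bar> / k"
      using R[of x y] st k by (simp add: abs_divide frac_le)
    also have "\<bar>R y * (t - s) / (s * t)\<bar> \<le> M * (C * L * \<omega> \<bar>x - y\<bar>) / (k * k)"
    proof -
      have "\<bar>R y\<bar> * \<bar>t - s\<bar> \<le> M * (C * L * \<omega> \<bar>x - y\<bar>)"
        using ts R_upper[of y] R_bounds(6)[of y] by (intro mult_mono) auto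
      moreover from this have "0 \<le> M * (C * L * \<omega> \<bar>x - y\<bar>)"
        by (rule order_trans[rotated]) simp
      moreover have "k * k \<le> s * t" using st k by (intro mult_mono) auto
      moreover have "0 < k * k" using k by simp
      moreover have "\<bar>s * t\<bar> = s * t" using st k by simp
      ultimately show ?thesis unfolding abs_divide abs_mult[of "R y"]
        by (simp only:) (intro frac_le, auto)
    qed
    finally show ?thesis by (simp add: algebra_simps)
  qed
  moreover have "0 < C / k + M * (C * L) / (k * k)"
    using C k L R_bounds(2) by (intro add_pos_pos divide_pos_pos mult_pos_pos) auto
  ultimately show ?thesis by blast
qed

text \<open>
  Two points governed by different branches are compared through a half-integer between them,
  where both formulas give the same value; this costs the factor \<open>2\<close>.
\<close>

lemma lift'_modulus:
  assumes \<omega>: "\<omega> \<in> concave_moduli" and C: "0 < C"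
    and R: "\<And>x y. \<bar>R x - R y\<bar> \<le> C * \<omega> \<bar>x - y\<bar>"
  shows "\<exists>K>0. \<forall>x y. \<bar>lift' x - lift' y\<bar> \<le> K * \<omega> \<bar>x - y\<bar>"
proof -
  obtain K1 where K1: "K1 > 0" "\<And>x y. \<bar>W' x - W' y\<bar> \<le> K1 * \<omega> \<bar>x - y\<bar>"
    using W'_modulus[OF assms] by blast
  define K where "K = K1 + 2 * C"
  have nn: "0 \<le> \<omega> \<bar>x - y\<bar>" for x y by (simp add: concave_moduli_nonneg[OF \<omega>])
  have bW: "\<bar>W' x - W' y\<bar> \<le> K * \<omega> \<bar>x - y\<bar>" for x y
    using K1(2)[of x y] mult_nonneg_nonneg[OF less_imp_le[OF C] nn[of x y]]
    by (simp add: K_def algebra_simps)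
  have bR: "\<bar>2 * R x - 2 * R y\<bar> \<le> K * \<omega> \<bar>x - y\<bar>" for x y
    using R[of x y] mult_nonneg_nonneg[OF less_imp_le[OF K1(1)] nn[of x y]]
    by (simp add: K_def algebra_simps)
  have K: "0 < K" using K1 C by (simp add: K_def)
  have le: "\<bar>lift' x - lift' y\<bar> \<le> 2 * K * \<omega> \<bar>x - y\<bar>" if xy: "x \<le> y" for x y
  proof (cases "even \<lfloor>2 * x\<rfloor> \<longleftrightarrow> even \<lfloor>2 * y\<rfloor>")
    case True
    then have "\<bar>lift' x - lift' y\<bar> \<le> K * \<omega> \<bar>x - y\<bar>"
      using bW[of x y] bR[of x y] by (auto simp: lift'_def)
    moreover have "0 \<le> K * \<omega> \<bar>x - y\<bar>" using K nn by simp
    ultimately show ?thesis by simp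
  next
    case False
    \<comment> \<open>the largest half-integer not exceeding \<open>y\<close>; it is at least \<open>x\<close> since the integer parts differ\<close>
    define z where "z = of_int \<lfloor>2 * y\<rfloor> / (2::real)"
    have "\<lfloor>2 * x\<rfloor> < \<lfloor>2 * y\<rfloor>" using False xy floor_mono[of "2 * x" "2 * y"] by fastforce
    then have z: "x \<le> z" "z \<le> y" unfolding z_def by linarith+
    have "\<bar>lift' x - 2 * R z\<bar> \<le> K * \<omega> \<bar>x - z\<bar>" "\<bar>lift' y - 2 * R z\<bar> \<le> K * \<omega> \<bar>y - z\<bar>"
      using bW[of x z] bR[of x z] bW[of y z] bR[of y z]
      by (auto simp: lift'_def z_def W'_half_int)
    moreover have "K * \<omega> \<bar>x - z\<bar> \<le> K * \<omega> \<bar>x - y\<bar>" "K * \<omega> \<bar>y - z\<bar> \<le> K * \<omega> \<bar>x - y\<bar>"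
      using K z by (auto intro!: mult_left_mono concave_moduli_mono[OF \<omega>])
    ultimately show ?thesis by (simp add: abs_le_iff)
  qed
  have "\<bar>lift' x - lift' y\<bar> \<le> 2 * K * \<omega> \<bar>x - y\<bar>" for x y
    using le[of x y] le[of y x] by (cases "x \<le> y") (auto simp: abs_minus_commute)
  then show ?thesis using K by (intro exI[of _ "2 * K"]) auto
qed

definition circle_density :: "circle \<Rightarrow> real"
  where "circle_density = descend R"

lemma circle_density_circle_of: "circle_density (circle_of x) = R x"
  by (simp add: circle_density_def descend_circle_of R_shift)

lemma continuous_on_circle_density: "continuous_on UNIV circle_density"
  using continuous_on_circle[of circle_density R] circle_density_circle_of continuous_R by blast

text \<open>
  The lower bound is required of \<open>R\<close> on the left half only, where the derivative of the map is
  \<open>2 R\<close> and no cancellation between \<open>R x\<close> and \<open>R (W x)\<close> can occur.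
\<close>

lemma optimal_moduli:
  assumes \<omega>: "\<omega> \<in> concave_moduli" and C: "0 < C"
    and upper: "\<And>x y. \<bar>R x - R y\<bar> \<le> C * \<omega> \<bar>x - y\<bar>"
    and c: "0 < c" and s0: "0 < s0"
    and lower: "\<And>s. 0 < s \<Longrightarrow> s \<le> s0 \<Longrightarrow>
      \<exists>x\<in>{0..1/2}. \<exists>y\<in>{0..1/2}. \<bar>x - y\<bar> \<le> s \<and> c * \<omega> s \<le> \<bar>R x - R y\<bar>"
  shows "circle_map \<in> expanding_C1_mod \<omega>"
    and "canonical_modulus UNIV circle_density \<simeq>\<^sub>m \<omega>"
    and "admissible_density \<omega> R"
proof -
  obtain K where K: "K > 0" "\<And>x y. \<bar>lift' x - lift' y\<bar> \<le> K * \<omega> \<bar>x - y\<bar>"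
    using lift'_modulus[OF \<omega> C upper] by blast
  have deriv_upper: "\<bar>circle_deriv circle_map p - circle_deriv circle_map q\<bar> \<le> K * \<omega> (dist p q)" for p q
    by (rule circle_dist_boundI) (simp add: circle_deriv_circle_map K(2))
  have density_upper: "\<bar>circle_density p - circle_density q\<bar> \<le> C * \<omega> (dist p q)" for p q
    by (rule circle_dist_boundI) (simp add: circle_density_circle_of upper)
  have lower': "\<exists>x\<in>{0..1/2}. \<exists>y\<in>{0..1/2}. dist (circle_of x) (circle_of y) \<le> s \<and>
      c * \<omega> s \<le> \<bar>R x - R y\<bar>" if "0 < s" "s \<le> s0" for s
    using lower[OF that] dist_circle_of_le order_trans by blast
  have deriv_lower: "\<exists>p\<in>UNIV. \<exists>q\<in>UNIV. dist p q \<le> s \<and>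
      2 * c * \<omega> s \<le> \<bar>circle_deriv circle_map p - circle_deriv circle_map q\<bar>"
    if s: "0 < s" "s \<le> s0" for s
  proof -
    obtain x y where xy: "x \<in> {0..1/2}" "y \<in> {0..1/2}"
      "dist (circle_of x) (circle_of y) \<le> s" "c * \<omega> s \<le> \<bar>R x - R y\<bar>"
      using lower'[OF s] by blast
    have "2 * c * \<omega> s \<le> \<bar>2 * R x - 2 * R y\<bar>" using xy(4) by linarith
    then show ?thesis
      using xy(3) lift'_left[OF xy(1)] lift'_left[OF xy(2)]
      by (intro bexI[of _ "circle_of x"] bexI[of _ "circle_of y"])
        (simp_all add: circle_deriv_circle_map)
  qed
  have density_lower: "\<exists>p\<in>UNIV. \<exists>q\<in>UNIV. dist p q \<le> s \<and>
      c * \<omega> s \<le> \<bar>circle_density p - circle_density q\<bar>" if s: "0 < s" "s \<le> s0" for s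
  proof -
    obtain x y where "dist (circle_of x) (circle_of y) \<le> s" "c * \<omega> s \<le> \<bar>R x - R y\<bar>"
      using lower'[OF s] by blast
    then show ?thesis
      by (intro bexI[of _ "circle_of x"] bexI[of _ "circle_of y"])
        (simp_all add: circle_density_circle_of)
  qed
  have "0 < 2 * c" using c by simp
  have "canonical_modulus UNIV (circle_deriv circle_map) \<simeq>\<^sub>m \<omega>"
    by (rule canonical_modulus_equivI(1)[OF \<omega> K(1) deriv_upper \<open>0 < 2 * c\<close> s0 deriv_lower])
  moreover have "circle_map \<in> expanding_C1"
  proof -
    have "continuous_on UNIV (circle_deriv circle_map)"
      by (rule continuous_on_of_modulus[OF \<omega> less_imp_le[OF K(1)] deriv_upper])
    moreover have "\<exists>D. has_circle_deriv circle_map D p" for p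
      using has_circle_deriv_circle_map circle_of_surj[of p] by blast
    moreover have "m / (M - 1/2) \<le> \<bar>circle_deriv circle_map p\<bar>" for p
    proof -
      obtain x where "p = circle_of x" using circle_of_surj by blast
      then show ?thesis using lift'_lower[of x] by (simp add: circle_deriv_circle_map)
    qed
    moreover have "1 < m / (M - 1/2)" using oscillation R_bounds(4) by simp
    ultimately show ?thesis unfolding expanding_C1_def circle_C1_def by blast
  qed
  ultimately show "circle_map \<in> expanding_C1_mod \<omega>" by (simp add: expanding_C1_mod_def)
  show "canonical_modulus UNIV circle_density \<simeq>\<^sub>m \<omega>"
    by (rule canonical_modulus_equivI(1)[OF \<omega> C density_upper c s0 density_lower])
  have "\<omega> \<simeq>\<^sub>m canonical_modulus {0..1} R"
  proof (rule canonical_modulus_equivI(2)[OF \<omega> C _ c s0])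
    show "\<exists>x\<in>{0..1}. \<exists>y\<in>{0..1}. dist x y \<le> s \<and> c * \<omega> s \<le> \<bar>R x - R y\<bar>"
      if "0 < s" "s \<le> s0" for s
      using lower[OF that] by (fastforce simp: dist_real_def)
  qed (simp add: dist_real_def upper)
  moreover have "Sup (R ` {0..1}) - Inf (R ` {0..1}) < 1/2"
  proof -
    have "Sup (R ` {0..1}) \<le> M" "m \<le> Inf (R ` {0..1})"
      using R_upper R_lower by (auto intro: cSUP_least cINF_greatest)
    then show ?thesis using oscillation by simp
  qed
  ultimately show "admissible_density \<omega> R"
    unfolding admissible_density_def
    using continuous_on_subset[OF continuous_R] R_bounds(5) left_mass right_mass R_0 R_shift[of 0 1]
    by auto
qed


section \<open>The invariant measure\<close>

definition invariant_measure :: "circle measure"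
  where "invariant_measure = density circle_lborel (\<lambda>p. ennreal (circle_density p))"

lemma circle_density_measurable [measurable]: "circle_density \<in> borel_measurable borel"
  using continuous_on_circle_density by (rule borel_measurable_continuous_onI)

lemma circle_map_measurable [measurable]: "circle_map \<in> borel_measurable borel"
  using continuous_on_circle_map by (rule borel_measurable_continuous_onI)

lemma circle_density_pos: "0 < circle_density p"
  using circle_of_surj[of p] circle_density_circle_of R_bounds(6) by metis

lemma sets_invariant_measure [simp, measurable_cong]: "sets invariant_measure = sets borel"
  by (simp add: invariant_measure_def circle_lborel_def)

lemma equivalent_invariant_measure: "equivalent_measures invariant_measure circle_lborel"
proof -
  have [measurable]: "(\<lambda>p. ennreal (circle_density p)) \<in> borel_measurable circle_lborel"
    by (simp add: circle_lborel_def)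
  have "null_sets (density circle_lborel (\<lambda>p. ennreal (circle_density p))) = null_sets circle_lborel"
  proof (rule set_eqI)
    fix A
    have "ennreal (circle_density p) \<noteq> 0" for p using circle_density_pos[of p] by simp
    then show "A \<in> null_sets (density circle_lborel (\<lambda>p. ennreal (circle_density p))) \<longleftrightarrow>
        A \<in> null_sets circle_lborel"
      by (simp add: null_sets_density_iff) (metis AE_iff_null_sets null_setsD2)
  qed
  then show ?thesis
    by (simp add: equivalent_measures_def absolutely_continuous_def invariant_measure_def)
qed

lemma nn_integral_circle_lborel:
  assumes [measurable]: "g \<in> borel_measurable borel"
  shows "(\<integral>\<^sup>+p. g p \<partial>circle_lborel) = (\<integral>\<^sup>+x. g (circle_of x) * indicator {0..1} x \<partial>lborel)"
proof -
  have "(\<integral>\<^sup>+p. g p \<partial>circle_lborel) = (\<integral>\<^sup>+x. g (circle_of x) \<partial>restrict_space lborel {0..<1})"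
    unfolding circle_lborel_def by (rule nn_integral_distr[OF measurable_circle_of]) simp
  also have "\<dots> = (\<integral>\<^sup>+x. g (circle_of x) * indicator {0..<1} x \<partial>lborel)"
    by (rule nn_integral_restrict_space) simp
  also have "\<dots> = (\<integral>\<^sup>+x. g (circle_of x) * indicator {0..1} x \<partial>lborel)"
  proof (rule nn_integral_cong_AE)
    show "AE x in lborel. g (circle_of x) * indicator {0..<1} x = g (circle_of x) * indicator {0..1} x"
      using AE_lborel_singleton[of 1] by eventually_elim (auto split: split_indicator)
  qed
  finally show ?thesis .
qed

lemma circle_of_measurable [measurable]: "circle_of \<in> borel_measurable borel"
  using continuous_on_circle_of by (rule borel_measurable_continuous_onI)

lemma emeasure_invariant_measure:
  assumes [measurable]: "A \<in> sets borel"
  shows "emeasure invariant_measure A =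
    (\<integral>\<^sup>+x. ennreal (R x * indicat_real A (circle_of x) * indicat_real {0..1} x) \<partial>lborel)"
proof -
  have "emeasure invariant_measure A =
      (\<integral>\<^sup>+p. ennreal (circle_density p) * indicator A p \<partial>circle_lborel)"
    unfolding invariant_measure_def by (rule emeasure_density) (simp_all add: circle_lborel_def)
  also have "\<dots> = (\<integral>\<^sup>+x. ennreal (R x) * indicator A (circle_of x) * indicator {0..1} x \<partial>lborel)"
    by (subst nn_integral_circle_lborel) (simp_all add: circle_density_circle_of)
  also have "\<dots> = (\<integral>\<^sup>+x. ennreal (R x * indicat_real A (circle_of x) * indicat_real {0..1} x) \<partial>lborel)"
    by (intro nn_integral_cong) (simp split: split_indicator)
  finally show ?thesis .
qed

lemma prob_space_invariant_measure: "prob_space invariant_measure"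
proof
  have "emeasure invariant_measure UNIV = (\<integral>\<^sup>+x. ennreal (R x) * indicator {0..1} x \<partial>lborel)"
    by (subst emeasure_invariant_measure) (auto intro!: nn_integral_cong split: split_indicator)
  also have "\<dots> = ennreal (G 1 - G 0)"
    by (rule nn_integral_FTC_Icc) (use G_has_derivative R_bounds(6) less_imp_le in auto)
  finally show "emeasure invariant_measure (space invariant_measure) = 1"
    by (simp add: sets_eq_imp_space_eq[OF sets_invariant_measure])
qed

lemma lift_measurable [measurable]: "lift \<in> borel_measurable borel"
  by (rule borel_measurable_continuous_onI[OF continuous_on_lift])

text \<open>
  The density is a fixed point of the transfer operator, here in integrated form. Substituting
  \<open>u = 2 G x\<close> on the left half turns \<open>R x dx\<close> into \<open>du / 2\<close>, and substituting \<open>u = W x - 1\<close> on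
  the right half turns it into \<open>dh(u) = (R u - 1/2) du\<close>; the two contributions add up to
  \<open>R u du\<close> over \<open>[0,1]\<close>.
\<close>

lemma transfer_identity:
  assumes [measurable]: "A \<in> sets borel"
  shows "(\<integral>\<^sup>+x. ennreal (R x * indicat_real A (circle_of (lift x)) * indicat_real {0..1} x) \<partial>lborel) =
    (\<integral>\<^sup>+x. ennreal (R x * indicat_real A (circle_of x) * indicat_real {0..1} x) \<partial>lborel)"
proof -
  define \<phi> where "\<phi> x = indicat_real A (circle_of x)" for x
  have [measurable]: "\<phi> \<in> borel_measurable borel" unfolding \<phi>_def by measurable
  have \<phi>0: "0 \<le> \<phi> x" for x by (simp add: \<phi>_def)
  have \<phi>_shift: "\<phi> (x - 1) = \<phi> x" for x
    using circle_of_add_int[of "-1" x] by (simp add: \<phi>_def)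
  have contR: "continuous_on S R" for S using continuous_R continuous_on_subset by blast
  have contRW: "continuous_on S (\<lambda>x. R (W x))" for S
    using continuous_on_compose2[OF continuous_R continuous_on_W[of S]] by simp
  have contW': "continuous_on S W'" for S
    unfolding W'_def [abs_def] using R_bounds(7)
    by (intro continuous_intros contR contRW ballI) (metis less_irrefl)
  have [measurable]: "W \<in> borel_measurable borel" "W' \<in> borel_measurable borel" "G \<in> borel_measurable borel"
    by (intro borel_measurable_continuous_onI contW' continuous_on_W continuous_on_G)+
  have left: "(\<integral>\<^sup>+x. ennreal (1/2 * \<phi> x * indicat_real {0..1} x) \<partial>lborel) =
      (\<integral>\<^sup>+x. ennreal (R x * \<phi> (lift x) * indicat_real {0..1/2} x) \<partial>lborel)"
  proof -
    have "(\<integral>\<^sup>+x. ennreal (1/2 * \<phi> x * indicat_real {2 * G 0..2 * G (1/2)} x) \<partial>lborel) =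
      (\<integral>\<^sup>+x. ennreal (1/2 * \<phi> (2 * G x) * (2 * R x) * indicat_real {0..1/2} x) \<partial>lborel)"
      by (rule nn_integral_substitution)
        (use double_G_has_derivative R_bounds(6) less_imp_le in
          \<open>auto simp: set_borel_measurable_def intro!: continuous_intros contR\<close>)
    also have "\<dots> = (\<integral>\<^sup>+x. ennreal (R x * \<phi> (lift x) * indicat_real {0..1/2} x) \<partial>lborel)"
      by (intro nn_integral_cong) (simp add: lift_left mult.commute split: split_indicator)
    finally show ?thesis by simp
  qed
  have right: "(\<integral>\<^sup>+x. ennreal ((R x - 1/2) * \<phi> x * indicat_real {0..1} x) \<partial>lborel) =
      (\<integral>\<^sup>+x. ennreal (R x * \<phi> (lift x) * indicat_real {1/2..1} x) \<partial>lborel)"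
  proof -
    have D: "((\<lambda>x. W x - 1) has_real_derivative W' x) (at x)" for x
      using DERIV_diff[OF W_has_derivative DERIV_const[of 1]] by simp
    have W'0: "0 \<le> W' x" for x
      using R_bounds(6)[of x] R_bounds(7)[of "W x"] by (simp add: W'_def)
    have "(\<integral>\<^sup>+x. ennreal ((R x - 1/2) * \<phi> x * indicat_real {W (1/2) - 1..W 1 - 1} x) \<partial>lborel) =
      (\<integral>\<^sup>+x. ennreal ((R (W x - 1) - 1/2) * \<phi> (W x - 1) * W' x * indicat_real {1/2..1} x) \<partial>lborel)"
      by (rule nn_integral_substitution)
        (use D W'0 contW' in \<open>auto simp: set_borel_measurable_def\<close>)
    also have "\<dots> = (\<integral>\<^sup>+x. ennreal (R x * \<phi> (lift x) * indicat_real {1/2..1} x) \<partial>lborel)"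
    proof (intro nn_integral_cong, goal_cases)
      case (1 x)
      have "(R (W x - 1) - 1/2) * W' x = R x"
        using R_bounds(7)[of "W x"] R_shift[of "W x" "-1"] by (simp add: W'_def)
      moreover have "(R (W x - 1) - 1/2) * \<phi> (W x - 1) * W' x =
          (R (W x - 1) - 1/2) * W' x * \<phi> (W x)"
        by (simp only: \<phi>_shift mult_ac)
      ultimately have "(R (W x - 1) - 1/2) * \<phi> (W x - 1) * W' x = R x * \<phi> (W x)"
        by (simp only:)
      then show ?case by (simp add: lift_right split: split_indicator)
    qed
    finally show ?thesis by simp
  qed
  \<comment> \<open>the point \<open>1/2\<close> is counted twice on the right, hence equality almost everywhere only\<close>
  have "(\<integral>\<^sup>+x. ennreal (R x * \<phi> (lift x) * indicat_real {0..1} x) \<partial>lborel) =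
      (\<integral>\<^sup>+x. ennreal (R x * \<phi> (lift x) * indicat_real {0..1/2} x) +
         ennreal (R x * \<phi> (lift x) * indicat_real {1/2..1} x) \<partial>lborel)"
  proof (rule nn_integral_cong_AE)
    show "AE x in lborel. ennreal (R x * \<phi> (lift x) * indicat_real {0..1} x) =
      ennreal (R x * \<phi> (lift x) * indicat_real {0..1/2} x) +
         ennreal (R x * \<phi> (lift x) * indicat_real {1/2..1} x)"
      using AE_lborel_singleton[of "1/2"] by eventually_elim (auto split: split_indicator)
  qed
  also have "\<dots> = (\<integral>\<^sup>+x. ennreal (R x * \<phi> (lift x) * indicat_real {0..1/2} x) \<partial>lborel) +
      (\<integral>\<^sup>+x. ennreal (R x * \<phi> (lift x) * indicat_real {1/2..1} x) \<partial>lborel)"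
    by (rule nn_integral_add) measurable
  also have "\<dots> = (\<integral>\<^sup>+x. ennreal (1/2 * \<phi> x * indicat_real {0..1} x) \<partial>lborel) +
      (\<integral>\<^sup>+x. ennreal ((R x - 1/2) * \<phi> x * indicat_real {0..1} x) \<partial>lborel)"
    unfolding left right ..
  also have "\<dots> = (\<integral>\<^sup>+x. ennreal (1/2 * \<phi> x * indicat_real {0..1} x) +
      ennreal ((R x - 1/2) * \<phi> x * indicat_real {0..1} x) \<partial>lborel)"
    by (rule nn_integral_add[symmetric]) measurable
  also have "\<dots> = (\<integral>\<^sup>+x. ennreal (R x * \<phi> x * indicat_real {0..1} x) \<partial>lborel)"
  proof (intro nn_integral_cong, goal_cases)
    case (1 x)
    have "0 \<le> (R x - 1/2) * \<phi> x" "0 \<le> 1/2 * \<phi> x"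
      using R_bounds(7)[of x] \<phi>0[of x] by simp_all
    then have "ennreal (1/2 * \<phi> x) + ennreal ((R x - 1/2) * \<phi> x) = ennreal (R x * \<phi> x)"
      by (simp add: algebra_simps flip: ennreal_plus)
    then show ?case by (simp split: split_indicator)
  qed
  finally show ?thesis by (simp add: \<phi>_def)
qed

lemma invariant_prob_invariant_measure: "invariant_prob circle_map invariant_measure"
  unfolding invariant_prob_def
proof (intro conjI)
  show meas: "circle_map \<in> measurable invariant_measure invariant_measure" by measurable
  show "distr invariant_measure invariant_measure circle_map = invariant_measure"
  proof (rule measure_eqI)
    fix A assume "A \<in> sets (distr invariant_measure invariant_measure circle_map)"
    then have A [measurable]: "A \<in> sets borel" by simp
    have pre: "circle_map -` A \<in> sets borel"
      using measurable_sets[OF circle_map_measurable A] by simp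
    have "emeasure (distr invariant_measure invariant_measure circle_map) A =
        emeasure invariant_measure (circle_map -` A)"
      using emeasure_distr[OF meas, of A] by (simp add: sets_eq_imp_space_eq[OF sets_invariant_measure])
    also have "\<dots> = emeasure invariant_measure A"
      unfolding emeasure_invariant_measure[OF pre] emeasure_invariant_measure[OF A]
      using transfer_identity[OF A] by (simp add: indicator_vimage circle_map_circle_of)
    finally show "emeasure (distr invariant_measure invariant_measure circle_map) A =
        emeasure invariant_measure A" .
  qed simp
qed (use prob_space_invariant_measure in simp_all)

end


section \<open>Densities with a prescribed modulus of continuity\<close>

definition tent :: "real \<Rightarrow> circle \<Rightarrow> real"
  where "tent c p = max 0 (1/8 - dist p (circle_of c))"

text \<open>
  Each tent has height \<open>1/8\<close> and support of length \<open>1/4\<close>, so the supports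
  \<open>[0,1/4]\<close> and \<open>[1/4,1/2]\<close> meet only at a point where both tents vanish.
\<close>

definition bumps :: "(real \<Rightarrow> real) \<Rightarrow> circle \<Rightarrow> real"
  where "bumps \<omega> p = \<omega> (tent (1/8) p) - \<omega> (tent (3/8) p)"

definition two_bump_density :: "(real \<Rightarrow> real) \<Rightarrow> real \<Rightarrow> real \<Rightarrow> real"
  where "two_bump_density \<omega> a x = 1 + a * bumps \<omega> (circle_of x)"

lemma tent_bounds: "0 \<le> tent c p" "tent c p \<le> 1/8"
  unfolding tent_def by (rule max.cobounded1) (rule max.boundedI, simp_all)

text \<open>
  Truncation at \<open>0\<close> does not increase differences, and the distance to a point is \<open>1\<close>-Lipschitz.
\<close>

lemma tent_lipschitz: "\<bar>tent c p - tent c q\<bar> \<le> dist p q"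
  using dist_triangle[of p "circle_of c" q] dist_triangle[of q "circle_of c" p]
  by (auto simp: tent_def dist_commute[of q p] max_def abs_le_iff)

lemma bumps_modulus:
  assumes \<omega>: "\<omega> \<in> concave_moduli"
  shows "\<bar>bumps \<omega> p - bumps \<omega> q\<bar> \<le> 2 * \<omega> (dist p q)"
proof -
  have "\<bar>\<omega> (tent c p) - \<omega> (tent c q)\<bar> \<le> \<omega> (dist p q)" for c
  proof -
    have "\<bar>\<omega> (tent c p) - \<omega> (tent c q)\<bar> \<le> \<omega> \<bar>tent c p - tent c q\<bar>"
      by (intro concave_moduli_diff[OF \<omega>] tent_bounds)
    also have "\<dots> \<le> \<omega> (dist p q)"
      by (intro concave_moduli_mono[OF \<omega>] tent_lipschitz) simp
    finally show ?thesis .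
  qed
  from this[of "1/8"] this[of "3/8"] show ?thesis by (simp add: bumps_def abs_le_iff)
qed

lemma bumps_bound:
  assumes \<omega>: "\<omega> \<in> concave_moduli"
  shows "\<bar>bumps \<omega> p\<bar> \<le> \<omega> (1/8)"
proof -
  have "0 \<le> \<omega> (tent c p)" "\<omega> (tent c p) \<le> \<omega> (1/8)" for c
    using concave_moduli_nonneg[OF \<omega>] concave_moduli_mono[OF \<omega>] tent_bounds by blast+
  from this[of "1/8"] this[of "3/8"] show ?thesis by (simp add: bumps_def abs_le_iff)
qed

lemma bumps_near_0:
  assumes \<omega>: "\<omega> \<in> concave_moduli" and "0 \<le> s" "s \<le> 1/8"
  shows "bumps \<omega> (circle_of s) = \<omega> s"
  using assms by (simp add: bumps_def tent_def dist_circle_of_short concave_moduli_zero)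

text \<open>
  The reflection \<open>x \<mapsto> 1/2 - x\<close> exchanges the centres \<open>1/8\<close> and \<open>3/8\<close>.
\<close>

lemma bumps_reflect: "bumps \<omega> (circle_of (1/2 - x)) = - bumps \<omega> (circle_of x)"
proof -
  have "dist (circle_of (1/2 - x)) (circle_of c) = dist (circle_of x) (circle_of (1/2 - c))" for c
    using infdist_Ints_minus[of "x - (1/2 - c)"] by (simp add: dist_circle_of algebra_simps)
  from this[of "1/8"] this[of "3/8"] show ?thesis by (simp add: bumps_def tent_def)
qed

lemma bumps_right:
  assumes \<omega>: "\<omega> \<in> concave_moduli" and x: "1/2 \<le> x" "x \<le> 1"
  shows "bumps \<omega> (circle_of x) = 0"
proof -
  have "1/8 \<le> dist (circle_of x) (circle_of (1/8))" "1/8 \<le> dist (circle_of x) (circle_of (3/8))"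
    by (rule circle_dist_ge, use x in simp, use x in simp)+
  then show ?thesis by (simp add: bumps_def tent_def)
qed

text \<open>
  The bound on \<open>a\<close> keeps the density within \<open>1/8\<close> of \<open>1\<close>; the mass of the left half is \<open>1/2\<close>
  because the two bumps cancel, and on the right half the density is constant.
\<close>

lemma balanced_two_bump_density:
  assumes \<omega>: "\<omega> \<in> concave_moduli" and a: "0 < a" "a * \<omega> (1/8) \<le> 1/8"
  shows "balanced_density (two_bump_density \<omega> a) (7/8) (9/8)"
proof
  let ?b = "\<lambda>x. bumps \<omega> (circle_of x)"
  have "continuous_on UNIV (bumps \<omega>)"
    using bumps_modulus[OF \<omega>] by (intro continuous_on_of_modulus[OF \<omega>, of 2]) auto
  from continuous_on_compose2[OF this continuous_on_circle_of]
  have cont: "continuous_on S ?b" for S by simp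
  have abs_bound: "\<bar>a * ?b x\<bar> \<le> 1/8" for x
  proof -
    have "\<bar>a * ?b x\<bar> \<le> a * \<omega> (1/8)" using bumps_bound[OF \<omega>] a(1) by (simp add: abs_mult)
    then show ?thesis using a(2) by simp
  qed
  have bound: "- (1/8) \<le> a * ?b x" "a * ?b x \<le> 1/8" for x
    using abs_bound[of x] by linarith+
  show "continuous_on UNIV (two_bump_density \<omega> a)"
    unfolding two_bump_density_def [abs_def] by (intro continuous_intros cont)
  show "two_bump_density \<omega> a (x + 1) = two_bump_density \<omega> a x" for x
    using circle_of_add_int[of 1 x] by (simp add: two_bump_density_def)
  show "7/8 \<le> two_bump_density \<omega> a x" "two_bump_density \<omega> a x \<le> 9/8" for x
    using bound[of x] by (simp_all add: two_bump_density_def)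
  show "two_bump_density \<omega> a 0 = 1"
    using bumps_near_0[OF \<omega>, of 0] by (simp add: two_bump_density_def concave_moduli_zero[OF \<omega>])
  have "integral {0..1/2} (\<lambda>x. 1 + a * ?b x) = integral {0..1/2::real} (\<lambda>x. 1) + a * integral {0..1/2} ?b"
    by (subst Henstock_Kurzweil_Integration.integral_add) (auto intro!: integrable_continuous_real continuous_intros cont)
  then show "integral {0..1/2} (two_bump_density \<omega> a) = 1/2"
    using integral_odd_reflect[OF cont, of "1/2"] bumps_reflect by (simp add: two_bump_density_def [abs_def])
  have "integral {1/2..1} (two_bump_density \<omega> a) = integral {1/2..1::real} (\<lambda>x. 1)"
    by (intro integral_cong) (simp add: two_bump_density_def bumps_right[OF \<omega>])
  then show "integral {1/2..1} (two_bump_density \<omega> a) = 1/2" by simp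
qed simp_all

definition two_bump_map :: "(real \<Rightarrow> real) \<Rightarrow> real \<Rightarrow> circle \<Rightarrow> circle"
  where "two_bump_map \<omega> a = balanced_density.circle_map (two_bump_density \<omega> a)"

text \<open>
  The modulus of continuity of the density is realised at the pairs \<open>(s, 0)\<close>, since the density
  is \<open>1 + a \<omega> s\<close> at \<open>s \<le> 1/8\<close>. The value of the derivative at \<open>1/8\<close> identifies \<open>a\<close>.
\<close>

lemma two_bump_map_properties:
  assumes \<omega>: "\<omega> \<in> concave_moduli" and a: "0 < a" "a * \<omega> (1/8) \<le> 1/8"
  shows "two_bump_map \<omega> a \<in> expanding_C1_mod \<omega>"
    and "admissible_density \<omega> (two_bump_density \<omega> a)"
    and "represented_by (left_branch (two_bump_density \<omega> a)) (right_branch (two_bump_density \<omega> a)) (two_bump_map \<omega> a)"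
    and "\<exists>\<mu> \<rho>f. invariant_prob (two_bump_map \<omega> a) \<mu> \<and> equivalent_measures \<mu> circle_lborel \<and>
         continuous_on UNIV \<rho>f \<and> (\<forall>p. 0 \<le> \<rho>f p) \<and>
         \<mu> = density circle_lborel (\<lambda>p. ennreal (\<rho>f p)) \<and>
         canonical_modulus UNIV \<rho>f \<simeq>\<^sub>m \<omega>"
    and "circle_deriv (two_bump_map \<omega> a) (circle_of (1/8)) = 2 * (1 + a * \<omega> (1/8))"
proof -
  interpret balanced_density "two_bump_density \<omega> a" "7/8" "9/8"
    by (rule balanced_two_bump_density[OF assms])
  have upper: "\<bar>two_bump_density \<omega> a x - two_bump_density \<omega> a y\<bar> \<le> 2 * a * \<omega> \<bar>x - y\<bar>" for x y
  proof -
    have "\<bar>two_bump_density \<omega> a x - two_bump_density \<omega> a y\<bar> =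
        a * \<bar>bumps \<omega> (circle_of x) - bumps \<omega> (circle_of y)\<bar>"
      using a(1) by (simp add: two_bump_density_def abs_mult flip: right_diff_distrib)
    also have "\<dots> \<le> a * (2 * \<omega> (dist (circle_of x) (circle_of y)))"
      using bumps_modulus[OF \<omega>] a(1) by (intro mult_left_mono) auto
    also have "\<dots> \<le> a * (2 * \<omega> \<bar>x - y\<bar>)"
      using a(1) dist_circle_of_le by (simp add: concave_moduli_mono[OF \<omega>])
    finally show ?thesis by simp
  qed
  have lower: "\<exists>x\<in>{0..1/2}. \<exists>y\<in>{0..1/2}. \<bar>x - y\<bar> \<le> s \<and>
      a * \<omega> s \<le> \<bar>two_bump_density \<omega> a x - two_bump_density \<omega> a y\<bar>" if "0 < s" "s \<le> 1/8" for s
    using that bumps_near_0[OF \<omega>, of s] bumps_near_0[OF \<omega>, of 0] concave_moduli_zero[OF \<omega>]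
    by (intro bexI[of _ s] bexI[of _ 0]) (auto simp: two_bump_density_def)
  have "0 < 2 * a" "0 < (1/8 :: real)" using a by simp_all
  note moduli = optimal_moduli[OF \<omega> this(1) upper a(1) this(2) lower]
  show "two_bump_map \<omega> a \<in> expanding_C1_mod \<omega>" "admissible_density \<omega> (two_bump_density \<omega> a)"
    using moduli by (simp_all add: two_bump_map_def)
  show "represented_by (left_branch (two_bump_density \<omega> a)) (right_branch (two_bump_density \<omega> a)) (two_bump_map \<omega> a)"
    unfolding two_bump_map_def by (rule represented_by_branches)
  show "\<exists>\<mu> \<rho>f. invariant_prob (two_bump_map \<omega> a) \<mu> \<and> equivalent_measures \<mu> circle_lborel \<and>
         continuous_on UNIV \<rho>f \<and> (\<forall>p. 0 \<le> \<rho>f p) \<and>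
         \<mu> = density circle_lborel (\<lambda>p. ennreal (\<rho>f p)) \<and>
         canonical_modulus UNIV \<rho>f \<simeq>\<^sub>m \<omega>"
  proof (intro exI conjI allI)
    show "invariant_prob (two_bump_map \<omega> a) invariant_measure"
      unfolding two_bump_map_def by (rule invariant_prob_invariant_measure)
    show "invariant_measure = density circle_lborel (\<lambda>p. ennreal (circle_density p))"
      by (rule invariant_measure_def)
  qed (use equivalent_invariant_measure continuous_on_circle_density circle_density_pos
      less_imp_le moduli(2) in blast)+
  show "circle_deriv (two_bump_map \<omega> a) (circle_of (1/8)) = 2 * (1 + a * \<omega> (1/8))"
    using bumps_near_0[OF \<omega>, of "1/8"]
    by (simp add: two_bump_map_def circle_deriv_circle_map lift'_left two_bump_density_def)
qed

theorem theorem1: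
  fixes \<omega> :: "real \<Rightarrow> real"
  assumes "\<omega> \<in> concave_moduli"
  shows "\<exists>A :: (circle \<Rightarrow> circle) set. uncountable A \<and> A \<subseteq> Gamma_C1 \<omega> \<and>
    (\<forall>f\<in>A.
      (\<exists>\<mu> \<rho>f. invariant_prob f \<mu> \<and> equivalent_measures \<mu> circle_lborel \<and>
         continuous_on UNIV \<rho>f \<and> (\<forall>p. 0 \<le> \<rho>f p) \<and>
         \<mu> = density circle_lborel (\<lambda>p. ennreal (\<rho>f p)) \<and>
         canonical_modulus UNIV \<rho>f \<simeq>\<^sub>m \<omega>) \<and>
      (\<exists>\<rho>. admissible_density \<omega> \<rho> \<and>
         represented_by (left_branch \<rho>) (right_branch \<rho>) f))"
proof -
  have pos: "0 < \<omega> (1/8)" using concave_moduli_pos[OF assms] by simp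
  define I where "I = {0<..1 / (8 * \<omega> (1/8))}"
  have I: "0 < a" "a * \<omega> (1/8) \<le> 1/8" if "a \<in> I" for a
    using that pos by (auto simp: I_def field_simps)
  note props = two_bump_map_properties[OF assms I]
  have "inj_on (two_bump_map \<omega>) I"
  proof (rule inj_onI)
    fix a b assume ab: "a \<in> I" "b \<in> I" "two_bump_map \<omega> a = two_bump_map \<omega> b"
    have "circle_deriv (two_bump_map \<omega> a) (circle_of (1/8)) = circle_deriv (two_bump_map \<omega> b) (circle_of (1/8))"
      using ab(3) by simp
    then have "2 * (1 + a * \<omega> (1/8)) = 2 * (1 + b * \<omega> (1/8))"
      unfolding props(5)[OF ab(1) ab(1)] props(5)[OF ab(2) ab(2)] .
    then show "a = b" using pos by simp
  qed
  moreover have "uncountable I"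
    using pos by (simp add: I_def uncountable_half_open_interval_2)
  ultimately have unc: "uncountable (two_bump_map \<omega> ` I)"
    using countable_image_inj_on by blast
  have sub: "two_bump_map \<omega> ` I \<subseteq> Gamma_C1 \<omega>"
  proof
    fix f assume "f \<in> two_bump_map \<omega> ` I"
    then obtain a where a: "a \<in> I" "f = two_bump_map \<omega> a" by blast
    obtain \<mu> where "invariant_prob f \<mu>" "equivalent_measures \<mu> circle_lborel"
      using props(4)[OF a(1) a(1)] unfolding a(2) by (elim exE conjE)
    then show "f \<in> Gamma_C1 \<omega>"
      using props(1)[OF a(1) a(1)] unfolding Gamma_C1_def a(2) by blast
  qed
  have dens: "\<exists>\<mu> \<rho>f. invariant_prob f \<mu> \<and> equivalent_measures \<mu> circle_lborel \<and>
      continuous_on UNIV \<rho>f \<and> (\<forall>p. 0 \<le> \<rho>f p) \<and>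
      \<mu> = density circle_lborel (\<lambda>p. ennreal (\<rho>f p)) \<and>
      canonical_modulus UNIV \<rho>f \<simeq>\<^sub>m \<omega>" if "f \<in> two_bump_map \<omega> ` I" for f
    using that
  proof (rule imageE)
    fix a assume a: "f = two_bump_map \<omega> a" "a \<in> I"
    show ?thesis unfolding a(1) by (rule props(4)[OF a(2) a(2)])
  qed
  have form: "\<exists>\<rho>. admissible_density \<omega> \<rho> \<and> represented_by (left_branch \<rho>) (right_branch \<rho>) f"
    if f: "f \<in> two_bump_map \<omega> ` I" for f
  proof -
    obtain a where a: "a \<in> I" "f = two_bump_map \<omega> a" using f by blast
    show ?thesis
      unfolding a(2) using props(2)[OF a(1) a(1)] props(3)[OF a(1) a(1)] by blast
  qed
  show ?thesis
    by (rule exI[of _ "two_bump_map \<omega> ` I"], intro conjI ballI; (rule unc sub | erule dens | erule form))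
qed

end
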